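(* Let $n\ge 2$ and let $t>0$. There are noncongruent convex bodies $K$ and $L$ in $\mathbb{R}^n$ that contain the Euclidean ball of radius $t$ centered at the origin in their interiors and such that $$V_i(K\cap S_t(\xi))=V_i(L\cap S_t(\xi))\qquad\text{for all }\xi\in S^{n-1}\text{ and all integers } 1\le i\le n.$$ Moreover, both $K$ and $L$ can be chosen to be $C^\infty_+$ bodies of revolution; and both can also be chosen to be polytopes.
   Context: A convex body in $\mathbb{R}^n$ is a compact convex set with nonempty interior; throughout, convex bodies are assumed to contain the origin in their interiors. $S^{n-1}$ is the unit sphere in $\mathbb{R}^n$. For $t>0$ and $\xi\in S^{n-1}$, the slab of width $2t$ perpendicular to $\xi$ is $$S_t(\xi)=\{x\in\mathbb{R}^n: |\langle x,\xi\rangle|\le t\}.$$ Two sets $C,D\subset\mathbb{R}^n$ are congruent if there is an isometry $T$ of $\mathbb{R}^n$ with $T(C)=D$. For a compact convex set $K\subset\mathbb{R}^n$, the intrinsic volumes $V_i(K)$ are defined by Steiner's formula $$\mathrm{vol}_n(K+\epsilon B_2^n)=\sum_{i=0}^n \kappa_{n-i}V_i(K)\epsilon^{n-i},\qquad \epsilon\ge 0,$$ where $+$ is Minkowski addition, $B_2^n$ is the closed unit Euclidean ball in $\mathbb{R}^n$, and $\kappa_{m}$ is the volume of the $m$-dimensional Euclidean unit ball. A convex body is of class $C^\infty_+$ if its boundary is a $C^\infty$ manifold in $\mathbb{R}^n$ with positive Gaussian curvature at each point. A body of revolution is a convex body that is rotationally symmetric about some line (invariant under all isometries of $\mathbb{R}^n$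 that fix that line pointwise). *)

theory Defs
  imports "HOL-Analysis.Analysis"
begin

section \<open>Convex bodies, slabs, congruence\<close>

definition convex_body :: "(real^'n) set \<Rightarrow> bool" where
  "convex_body K \<longleftrightarrow> compact K \<and> convex K \<and> interior K \<noteq> {}"

definition slab :: "real \<Rightarrow> real^'n \<Rightarrow> (real^'n) set" where
  "slab t \<xi> = {x. \<bar>x \<bullet> \<xi>\<bar> \<le> t}"

text \<open>Distance-preserving maps of Euclidean space to itself are automatically onto.\<close>
definition isometry :: "(real^'n \<Rightarrow> real^'n) \<Rightarrow> bool" where
  "isometry T \<longleftrightarrow> (\<forall>x y. dist (T x) (T y) = dist x y)"

definition congruent_sets :: "(real^'n) set \<Rightarrow> (real^'n) set \<Rightarrow> bool" where
  "congruent_sets C D \<longleftrightarrow> (\<exists>T. isometry T \<and> T ` C = D)"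

section \<open>Intrinsic volumes\<close>

text \<open>
  The sum of sets is the Minkowski sum. In degree 0 at \<open>\<epsilon> = 0\<close> the convention \<open>0 ^ 0 = 1\<close> applies.
  The coefficients beyond the dimension do not occur in Steiner's formula and are set to 0.
\<close>
definition steiner_coeffs :: "(real^'n) set \<Rightarrow> (nat \<Rightarrow> real) \<Rightarrow> bool" where
  "steiner_coeffs K V \<longleftrightarrow>
     (\<forall>\<epsilon>\<ge>0. measure lebesgue (K + (\<lambda>x. \<epsilon> *\<^sub>R x) ` cball 0 1) =
        (\<Sum>i\<le>CARD('n). unit_ball_vol (real (CARD('n) - i)) * V i * \<epsilon> ^ (CARD('n) - i))) \<and>
     (\<forall>i>CARD('n). V i = 0)"

text \<open>
  The description below is meaningful for nonempty compact convex \<open>K\<close>: the coefficients exist by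
  Steiner's theorem, and they are unique by the following lemma.
\<close>
definition intrinsic_volume :: "nat \<Rightarrow> (real^'n) set \<Rightarrow> real" where
  "intrinsic_volume i K = (THE V. steiner_coeffs K V) i"

lemma steiner_coeffs_unique:
  fixes K :: "(real^'n) set"
  assumes V: "steiner_coeffs K V" and W: "steiner_coeffs K W"
  shows "V = W"
proof
  fix j
  let ?n = "CARD('n)"
  let ?d = "\<lambda>m. unit_ball_vol (real m) * (V (?n - m) - W (?n - m))"
  show "V j = W j"
  proof (cases "j \<le> ?n")
    case False
    then show ?thesis using V W by (simp add: steiner_coeffs_def)
  next
    case True
    have rev: "(\<Sum>i\<le>?n. g (?n - i) i) = (\<Sum>m\<le>?n. g m (?n - m))" for g :: "nat \<Rightarrow> nat \<Rightarrow> real"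
      by (rule sum.reindex_bij_witness[of _ "\<lambda>m. ?n - m" "\<lambda>m. ?n - m"]) auto
    have zero: "(\<Sum>m\<le>?n. ?d m * \<epsilon> ^ m) = 0" if "\<epsilon> \<ge> 0" for \<epsilon> :: real
    proof -
      have "(\<Sum>i\<le>?n. unit_ball_vol (real (?n - i)) * V i * \<epsilon> ^ (?n - i)) =
            (\<Sum>i\<le>?n. unit_ball_vol (real (?n - i)) * W i * \<epsilon> ^ (?n - i))"
        using V W that by (simp add: steiner_coeffs_def)
      then show ?thesis
        unfolding rev[of "\<lambda>m i. unit_ball_vol (real m) * V i * \<epsilon> ^ m"]
          rev[of "\<lambda>m i. unit_ball_vol (real m) * W i * \<epsilon> ^ m"]
        by (simp add: algebra_simps sum_subtractf)
    qed
    have "infinite {\<epsilon>::real. \<epsilon> \<ge> 0}"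
      using infinite_Ici[of "0::real"] by (simp add: atLeast_def)
    moreover have "{\<epsilon>::real. \<epsilon> \<ge> 0} \<subseteq> {z. (\<Sum>m\<le>?n. ?d m * z ^ m) = 0}"
      using zero by blast
    ultimately have "infinite {z. (\<Sum>m\<le>?n. ?d m * z ^ m) = 0}"
      using finite_subset by blast
    then have "\<forall>m\<le>?n. ?d m = 0"
      using polyfun_finite_roots[of ?d ?n] by blast
    then have "?d (?n - j) = 0" by simp
    moreover have "unit_ball_vol (real (?n - j)) \<noteq> 0"
      using unit_ball_vol_pos[of "real (?n - j)"] by linarith
    ultimately show ?thesis using True by simp
  qed
qed

section \<open>Smooth hypersurfaces and Gaussian curvature\<close>

text \<open>\<open>Ck_on k U f\<close> is meant for open \<open>U\<close>.\<close>
primrec Ck_on :: "nat \<Rightarrow> ('a::real_normed_vector) set \<Rightarrow> ('a \<Rightarrow> 'b::real_normed_vector) \<Rightarrow> bool" where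
  "Ck_on 0 U f \<longleftrightarrow> continuous_on U f"
| "Ck_on (Suc k) U f \<longleftrightarrow>
     (\<forall>x\<in>U. f differentiable (at x)) \<and> (\<forall>v. Ck_on k U (\<lambda>x. frechet_derivative f (at x) v))"

definition smooth_on :: "('a::real_normed_vector) set \<Rightarrow> ('a \<Rightarrow> 'b::real_normed_vector) \<Rightarrow> bool" where
  "smooth_on U f \<longleftrightarrow> (\<forall>k. Ck_on k U f)"

text \<open>
  An \<open>(n - 1)\<close>-dimensional \<open>C\<^sup>\<infinity>\<close> manifold in \<open>\<real>\<^sup>n\<close>: around each of its points, a diffeomorphism
  between open sets of \<open>\<real>\<^sup>n\<close> flattens it to a piece of a coordinate hyperplane.
\<close>
definition smooth_hypersurface :: "(real^'n) set \<Rightarrow> bool" where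
  "smooth_hypersurface M \<longleftrightarrow>
     (\<forall>p\<in>M. \<exists>(U :: (real^'n) set) (V :: (real^'n) set) h g k.
        open U \<and> open V \<and> p \<in> U \<and> homeomorphism U V h g \<and>
        smooth_on U h \<and> smooth_on V g \<and> h ` (M \<inter> U) = V \<inter> {y. y $ k = 0})"

text \<open>The Gauss map; at a boundary point of a convex body with smooth boundary there is exactly one
  outer unit normal.\<close>
definition outer_normal :: "(real^'n) set \<Rightarrow> real^'n \<Rightarrow> real^'n" where
  "outer_normal K x = (THE u. norm u = 1 \<and> (\<forall>y\<in>K. (y - x) \<bullet> u \<le> 0))"

text \<open>
  The Gaussian curvature at \<open>x\<close> is the determinant of the Weingarten map, i.e. of the differential
  \<open>W\<close> of the Gauss map \<open>\<nu>\<close> as an endomorphism of the tangent space \<open>T = \<nu>(x)\<^sup>\<bottom>\<close>. That determinant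
  is computed here as the determinant of the endomorphism of \<open>\<real>\<^sup>n\<close> that equals \<open>W\<close> on \<open>T\<close> and is the
  identity on the normal line. The derivative relative to the boundary determines \<open>W\<close> on \<open>T\<close> only,
  and only these values are used. With the outer normal, the sign is such that spheres have positive
  curvature in every dimension.
\<close>
definition has_Gauss_curvature :: "(real^'n) set \<Rightarrow> real^'n \<Rightarrow> real \<Rightarrow> bool" where
  "has_Gauss_curvature K x \<kappa> \<longleftrightarrow>
     (\<exists>W. (outer_normal K has_derivative W) (at x within frontier K) \<and>
        \<kappa> = det (matrix (\<lambda>v. let u = outer_normal K x; w = (v \<bullet> u) *\<^sub>R u in W (v - w) + w)))"

definition C_infinity_plus :: "(real^'n) set \<Rightarrow> bool" where
  "C_infinity_plus K \<longleftrightarrow> convex_body K \<and> smooth_hypersurface (frontier K) \<and>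
     (\<forall>x\<in>frontier K. \<exists>\<kappa>>0. has_Gauss_curvature K x \<kappa>)"

definition body_of_revolution :: "(real^'n) set \<Rightarrow> bool" where
  "body_of_revolution K \<longleftrightarrow> convex_body K \<and>
     (\<exists>l. affine l \<and> aff_dim l = 1 \<and>
        (\<forall>T. isometry T \<and> (\<forall>x\<in>l. T x = x) \<longrightarrow> T ` K = K))"

section \<open>Noncongruent bodies with the same intrinsic volumes of slab sections\<close>

definition noncongruent_slab_pair :: "real \<Rightarrow> (real^'n) set \<Rightarrow> (real^'n) set \<Rightarrow> bool" where
  "noncongruent_slab_pair t K L \<longleftrightarrow>
     convex_body K \<and> convex_body L \<and> \<not> congruent_sets K L \<and>
     cball 0 t \<subseteq> interior K \<and> cball 0 t \<subseteq> interior L \<and>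
     (\<forall>\<xi>\<in>sphere 0 1. \<forall>i\<in>{1..CARD('n)}.
        intrinsic_volume i (K \<inter> slab t \<xi>) = intrinsic_volume i (L \<inter> slab t \<xi>))"

end

theory Submission
  imports Defs
begin

text \<open>
  A slab \<open>S\<close> is symmetric about the origin, so a piece cut off a symmetric body near \<open>x\<close> changes the
  slab section in the same way as the reflected piece cut off near \<open>-x\<close>. Let \<open>A\<close> and \<open>B\<close> be two compact convex sets
  such that \<open>A \<union> B = A \<union> -B\<close> is convex; think of a symmetric body from which \<open>A\<close> and \<open>B\<close> arise by
  removing small pieces at different places. Put \<open>K = A \<inter> B\<close> and \<open>L = A \<inter> -B\<close>. For fixed \<open>\<epsilon>\<close> the
  volume \<open>\<mu>(X)\<close> of the parallel set \<open>(X \<inter> S) + \<epsilon>B\<^sub>2\<close> is a valuation: if \<open>C \<union> D\<close> is convex, then the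
  parallel set of \<open>C \<inter> D\<close> is the intersection of the parallel sets (\<open>set_plus_Int_if_convex_Un\<close>). Therefore
  \<open>\<mu>(K) = \<mu>(A) + \<mu>(B) - \<mu>(A \<union> B) = \<mu>(A) + \<mu>(-B) - \<mu>(A \<union> -B) = \<mu>(L)\<close>,
  and intrinsic volumes are determined by the volumes of the parallel sets
  (\<open>intrinsic_volume_slab_section_reflect_cut\<close>).

  All bodies have the form \<open>{x. N x \<le> f (x $ k)}\<close>, where \<open>N x\<close> measures the size of the coordinates other
  than the \<open>k\<close>-th and the concave profile \<open>f\<close> gives the thickness at each height \<open>x $ k\<close>. The
  symmetric body has an even profile; \<open>A\<close> and \<open>B\<close> lower it at two different positive heights. So \<open>K\<close> has
  both dents in the upper half and \<open>L\<close> has one in each half. The symmetric body is elongated: its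
  poles are the only two points at maximal distance. Hence an isometry from \<open>K\<close> onto \<open>L\<close>
  respects norms, and heights up to a common sign, so that a section of \<open>K\<close> cannot be
  thicker than the section of \<open>L\<close> at the same, or else at the opposite, height (\<open>isometry_profile_le\<close>).
  Both signs are impossible, since \<open>L\<close> has a dent in each half and \<open>K\<close> has none in the lower half.

  With the \<open>\<ell>\<^sub>1\<close>-length as \<open>N\<close> and a piecewise linear profile, whose corners are cut off, the bodies
  are polytopes. With the Euclidean length as \<open>N\<close> they are bodies of revolution. There the symmetric
  body is a spheroid, and the dents are made by adding \<open>C\<^sup>\<infinity>\<close> bumps to the quadratic form that defines
  it. If the second derivatives of the bumps are small, the Hessian stays positive definite, which
  yields convexity and positive Gaussian curvature (\<open>Gauss_curvature_pos\<close>). The boundary is a smooth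
  hypersurface because the defining equation can be solved for one coordinate by a square root
  (\<open>level_set_chart\<close>).
\<close>

section \<open>Intrinsic volumes of slab sections\<close>

text \<open>
  If \<open>c + a = d + b\<close> with \<open>c \<in> C\<close> and \<open>d \<in> D\<close>, the segment from \<open>c\<close> to \<open>d\<close> stays in \<open>C \<union> D\<close>, and being
  connected it meets \<open>C \<inter> D\<close> in a point \<open>z\<close>. The corresponding convex combination of \<open>a\<close> and \<open>b\<close>
  leads from \<open>z\<close> to the common sum.
\<close>
lemma set_plus_Int_if_convex_Un:
  fixes C D E :: "('a::real_normed_vector) set"
  assumes "closed C" "closed D" "convex (C \<union> D)" "convex E"
  shows "(C \<inter> D) + E = (C + E) \<inter> (D + E)"
proof
  show "(C \<inter> D) + E \<subseteq> (C + E) \<inter> (D + E)"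
    by (auto simp: set_plus_def)
  show "(C + E) \<inter> (D + E) \<subseteq> (C \<inter> D) + E"
  proof
    fix x assume "x \<in> (C + E) \<inter> (D + E)"
    then obtain c a d b where x: "c \<in> C" "a \<in> E" "x = c + a" "d \<in> D" "b \<in> E" "x = d + b"
      by (auto simp: set_plus_def)
    have seg: "closed_segment c d \<subseteq> C \<union> D"
      using x assms(3) by (intro closed_segment_subset) auto
    have "C \<inter> D \<inter> closed_segment c d \<noteq> {}"
      using connected_segment(1)[of c d] assms(1,2) seg x(1,4) ends_in_segment[of c d]
      unfolding connected_closed by blast
    then obtain z where z: "z \<in> C" "z \<in> D" "z \<in> closed_segment c d" by auto
    then obtain u where u: "0 \<le> u" "u \<le> 1" "z = (1 - u) *\<^sub>R c + u *\<^sub>R d"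
      by (auto simp: in_segment)
    have "(1 - u) *\<^sub>R a + u *\<^sub>R b \<in> E"
      using assms(4) x u by (auto simp: convex_alt)
    moreover have "x = z + ((1 - u) *\<^sub>R a + u *\<^sub>R b)"
    proof -
      have "x = (1 - u) *\<^sub>R (c + a) + u *\<^sub>R (d + b)"
        by (metis x(3,6) scaleR_left.add diff_add_cancel scaleR_one)
      then show ?thesis unfolding u(3) by (simp add: algebra_simps)
    qed
    ultimately show "x \<in> (C \<inter> D) + E"
      using z by (auto intro: set_plus_intro)
  qed
qed

lemma compact_set_plus:
  fixes C D :: "('a::real_normed_vector) set"
  assumes "compact C" "compact D"
  shows "compact (C + D)"
proof -
  have "C + D = {x + y |x y. x \<in> C \<and> y \<in> D}" by (auto simp: set_plus_def)
  then show ?thesis using compact_sums[OF assms] by simp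
qed

lemma measure_Un_plus_Int:
  assumes "A \<in> fmeasurable M" "B \<in> fmeasurable M"
  shows "measure M (A \<union> B) + measure M (A \<inter> B) = measure M A + measure M B"
  using measure_Un3[OF assms] by simp

text \<open>
  The valuation property of the volume of parallel sets.
\<close>
lemma parallel_body_measure_Un_plus_Int:
  fixes C D E :: "('a::euclidean_space) set"
  assumes "compact C" "compact D" "convex (C \<union> D)" "compact E" "convex E"
  shows "measure lebesgue ((C \<union> D) + E) + measure lebesgue ((C \<inter> D) + E)
    = measure lebesgue (C + E) + measure lebesgue (D + E)"
proof -
  have "(C \<union> D) + E = (C + E) \<union> (D + E)" by (auto simp: set_plus_def)
  moreover have "(C \<inter> D) + E = (C + E) \<inter> (D + E)"
    using assms by (intro set_plus_Int_if_convex_Un) (auto simp: compact_imp_closed)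
  ultimately show ?thesis
    using assms by (simp add: measure_Un_plus_Int lmeasurable_compact compact_set_plus)
qed

lemma image_uminus_eq: "uminus ` S = {x. - x \<in> S}" for S :: "'a::group_add set"
  by (force simp: image_iff)

lemma measure_lebesgue_uminus:
  fixes S :: "('a::euclidean_space) set"
  shows "measure lebesgue (uminus ` S) = measure lebesgue S"
  using measure_lebesgue_affine[of "-1" 0 S] by (simp cong: image_cong_simp)

lemma parallel_body_measure_uminus:
  fixes C E :: "('a::euclidean_space) set"
  assumes "uminus ` E = E"
  shows "measure lebesgue (uminus ` C + E) = measure lebesgue (C + E)"
proof -
  have "uminus ` (C + E) = uminus ` C + uminus ` E"
  proof (intro subset_antisym subsetI)
    fix x assume "x \<in> uminus ` (C + E)"
    then obtain c e where "c \<in> C" "e \<in> E" "x = - c + - e"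
      by (auto elim!: set_plus_elim)
    then show "x \<in> uminus ` C + uminus ` E" by (metis set_plus_intro imageI)
  next
    fix x assume "x \<in> uminus ` C + uminus ` E"
    then obtain c e where "c \<in> C" "e \<in> E" "x = - (c + e)"
      by (auto elim!: set_plus_elim)
    then show "x \<in> uminus ` (C + E)" by (metis set_plus_intro imageI)
  qed
  then have "uminus ` C + E = uminus ` (C + E)"
    using assms by simp
  then show ?thesis by (simp only: measure_lebesgue_uminus)
qed

text \<open>
  Equal parallel volumes mean that the two sets have the same Steiner coefficients.
\<close>
lemma intrinsic_volume_cong:
  fixes K L :: "(real^'n::finite) set"
  assumes "\<And>\<epsilon>. \<epsilon> \<ge> 0 \<Longrightarrow> measure lebesgue (K + (\<lambda>x. \<epsilon> *\<^sub>R x) ` cball 0 1)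
    = measure lebesgue (L + (\<lambda>x. \<epsilon> *\<^sub>R x) ` cball 0 1)"
  shows "intrinsic_volume i K = intrinsic_volume i L"
proof -
  have "steiner_coeffs K = steiner_coeffs L"
    using assms by (auto simp: fun_eq_iff steiner_coeffs_def)
  then show ?thesis by (simp add: intrinsic_volume_def)
qed

lemma closed_slab: "closed (slab t \<xi>)"
  unfolding slab_def by (intro closed_Collect_le continuous_intros)

lemma convex_slab: "convex (slab t \<xi>)"
proof -
  have "slab t \<xi> = {x. \<xi> \<bullet> x \<le> t} \<inter> {x. \<xi> \<bullet> x \<ge> - t}"
    by (auto simp: slab_def inner_commute)
  then show ?thesis
    by (simp add: convex_Int convex_halfspace_le convex_halfspace_ge)
qed

lemma uminus_slab: "uminus ` (slab t \<xi>) = slab t \<xi>"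
  by (simp add: image_uminus_eq slab_def)

text \<open>
  The valuation property is applied to \<open>A\<close>, \<open>B\<close> and to \<open>A\<close>, \<open>-B\<close>. The unions agree by assumption, and
  \<open>B\<close> and \<open>-B\<close> have slab sections that are reflections of each other.
\<close>
lemma intrinsic_volume_slab_section_reflect_cut:
  fixes A B :: "(real^'n::finite) set"
  assumes A: "compact A" and B: "compact B"
    and cvx: "convex (A \<union> B)" and sym: "A \<union> uminus ` B = A \<union> B"
  shows "intrinsic_volume i (A \<inter> B \<inter> slab t \<xi>) = intrinsic_volume i (A \<inter> uminus ` B \<inter> slab t \<xi>)"
proof (rule intrinsic_volume_cong)
  fix \<epsilon> :: real assume "\<epsilon> \<ge> 0"
  let ?S = "slab t \<xi>" and ?E = "(\<lambda>x. \<epsilon> *\<^sub>R x) ` cball (0::real^'n) 1"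
  let ?\<mu> = "\<lambda>X. measure lebesgue (X \<inter> ?S + ?E)"
  have E: "compact ?E" "convex ?E"
    by (auto intro!: compact_scaling convex_scaling)
  have Esym: "uminus ` ?E = ?E"
  proof -
    have "uminus ` ?E = (\<lambda>x. \<epsilon> *\<^sub>R x) ` uminus ` cball (0::real^'n) 1"
      by (simp add: image_image)
    also have "uminus ` cball (0::real^'n) 1 = cball 0 1"
      by (simp add: image_uminus_eq mem_cball_0 set_eq_iff)
    finally show ?thesis .
  qed
  have valuation: "?\<mu> (A \<union> C) + ?\<mu> (A \<inter> C) = ?\<mu> A + ?\<mu> C"
    if "compact C" "convex (A \<union> C)" for C
  proof -
    have eq: "(A \<union> C) \<inter> ?S = (A \<inter> ?S) \<union> (C \<inter> ?S)" "(A \<inter> C) \<inter> ?S = (A \<inter> ?S) \<inter> (C \<inter> ?S)"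
      by auto
    have "convex ((A \<inter> ?S) \<union> (C \<inter> ?S))"
      unfolding eq(1)[symmetric] by (intro convex_Int that convex_slab)
    then show ?thesis
      unfolding eq using A that E
      by (intro parallel_body_measure_Un_plus_Int) (auto simp: compact_Int_closed closed_slab)
  qed
  have "compact (uminus ` B)"
    using B by (intro compact_continuous_image continuous_intros) auto
  then have "?\<mu> (A \<union> B) + ?\<mu> (A \<inter> uminus ` B) = ?\<mu> A + ?\<mu> (uminus ` B)"
    using valuation[of "uminus ` B"] cvx sym by simp
  moreover have "?\<mu> (uminus ` B) = ?\<mu> B"
  proof -
    have "uminus ` B \<inter> ?S = uminus ` (B \<inter> ?S)"
      by (simp add: image_Int uminus_slab)
    then show ?thesis using parallel_body_measure_uminus[OF Esym] by simp
  qed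
  ultimately show "?\<mu> (A \<inter> B) = ?\<mu> (A \<inter> uminus ` B)"
    using valuation[OF B cvx] by linarith
qed

section \<open>Noncongruence of elongated bodies\<close>

lemma norm_power2_eq_sum: "norm x ^ 2 = (\<Sum>i\<in>UNIV. (x $ i)^2)" for x :: "real^'n::finite"
  unfolding power2_norm_eq_inner by (simp add: inner_vec_def power2_eq_square)

lemma norm_power2_minus_component:
  "norm x ^ 2 - (x $ k)^2 = (\<Sum>i\<in>UNIV - {k}. (x $ i)^2)" for x :: "real^'n::finite"
  unfolding norm_power2_eq_sum by (simp add: sum.remove[of UNIV k])

lemma two_coordinates:
  assumes "CARD('n::finite) \<ge> 2"
  obtains k j :: "'n::finite" where "j \<noteq> k"
  using assms
  by (metis One_nat_def card_le_Suc0_iff_eq finite not_less_eq_eq numeral_2_eq_2 UNIV_I)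

text \<open>
  The distances from \<open>p\<close> and \<open>-p\<close> to a point determine its norm and its inner product with \<open>p\<close>. This
  recovers norm and height of an image point from the images of the two poles.
\<close>
lemma norm_inner_eq_if_norm_diff_add_eq:
  fixes u v p q :: "'a::real_inner"
  assumes "norm (u - q) ^ 2 = norm (v - p) ^ 2" "norm (u + q) ^ 2 = norm (v + p) ^ 2" "norm q = norm p"
  shows "norm u ^ 2 = norm v ^ 2" "u \<bullet> q = v \<bullet> p"
proof -
  have *: "norm (u - q) ^ 2 = norm u ^ 2 - 2 * (u \<bullet> q) + norm q ^ 2"
      "norm (u + q) ^ 2 = norm u ^ 2 + 2 * (u \<bullet> q) + norm q ^ 2" for u q :: 'a
    unfolding power2_norm_eq_inner by (simp_all add: inner_diff inner_add inner_commute algebra_simps)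
  show "norm u ^ 2 = norm v ^ 2" "u \<bullet> q = v \<bullet> p"
    using assms(1,2) unfolding * assms(3) by linarith+
qed

definition profile_body :: "(real^'n \<Rightarrow> real) \<Rightarrow> 'n \<Rightarrow> (real \<Rightarrow> real) \<Rightarrow> (real^'n) set" where
  "profile_body N k f = {x. N x \<le> f (x $ k)}"

lemma profile_body_Un: "profile_body N k f \<union> profile_body N k g = profile_body N k (\<lambda>h. max (f h) (g h))"
  by (auto simp: profile_body_def)

lemma profile_body_Int: "profile_body N k f \<inter> profile_body N k g = profile_body N k (\<lambda>h. min (f h) (g h))"
  by (auto simp: profile_body_def)

lemma uminus_profile_body:
  assumes "\<And>x. N (- x) = N x"
  shows "uminus ` profile_body N k f = profile_body N k (\<lambda>h. f (- h))"
  by (simp add: image_uminus_eq profile_body_def assms)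

text \<open>
  \<open>N\<close> dominates the Euclidean length of the coordinates other than the \<open>k\<close>-th, with equality
  in the direction of axis \<open>j\<close>. So a nonnegative profile value is the largest Euclidean distance from the axis
  \<open>k\<close> that occurs in the section of the profile body at a given height.
\<close>
locale profile_gauge =
  fixes N :: "real^'n::finite \<Rightarrow> real" and k j :: 'n
  assumes jk: "j \<noteq> k"
    and cont: "continuous_on UNIV N"
    and minus: "N (- x) = N x"
    and dominates: "norm x ^ 2 - (x $ k) ^ 2 \<le> (N x) ^ 2"
    and nonneg: "0 \<le> N x"
    and on_plane: "N (axis k h + axis j s) = \<bar>s\<bar>"
begin

lemma closed_profile_body:
  assumes "continuous_on UNIV f"
  shows "closed (profile_body N k f)"
  unfolding profile_body_def
  by (intro closed_Collect_le cont continuous_intros continuous_on_compose2[OF assms]) auto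

lemma open_profile_interior:
  assumes "continuous_on UNIV f"
  shows "open {x. N x < f (x $ k)}"
  by (intro open_Collect_less cont continuous_intros continuous_on_compose2[OF assms]) auto

end

text \<open>
  Negative profile values stand for empty sections. Rotating the graph of \<open>f\<close> about the
  height axis gives a set inside the ball of radius \<open>R\<close> that touches the sphere at most at the poles.
\<close>
definition elongated :: "real \<Rightarrow> (real \<Rightarrow> real) \<Rightarrow> bool" where
  "elongated R f \<longleftrightarrow> R > 0 \<and> (\<forall>h. f h \<ge> 0 \<longrightarrow> h^2 + (f h)^2 \<le> R^2) \<and>
     (\<forall>h. f h \<ge> 0 \<longrightarrow> h^2 + (f h)^2 = R^2 \<longrightarrow> h^2 = R^2)"

lemma elongated_mono:
  assumes "elongated R f" "\<And>h. g h \<le> f h"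
  shows "elongated R g"
  unfolding elongated_def
proof (intro conjI allI impI)
  show "R > 0" using assms by (simp add: elongated_def)
  fix h assume g: "0 \<le> g h"
  then have *: "0 \<le> f h" "(g h)^2 \<le> (f h)^2"
    using assms(2)[of h] by (auto intro: power_mono)
  then have f: "h\<^sup>2 + (f h)\<^sup>2 \<le> R\<^sup>2" "h\<^sup>2 + (f h)\<^sup>2 = R\<^sup>2 \<Longrightarrow> h\<^sup>2 = R\<^sup>2"
    using assms(1) by (auto simp: elongated_def)
  show "h\<^sup>2 + (g h)\<^sup>2 \<le> R\<^sup>2" using f * by linarith
  show "h\<^sup>2 = R\<^sup>2" if "h\<^sup>2 + (g h)\<^sup>2 = R\<^sup>2"
    using f * that by linarith
qed

context profile_gauge
begin

lemma norm_le_elongation: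
  assumes "elongated R f" "x \<in> profile_body N k f"
  shows "norm x \<le> R"
proof -
  have f: "0 \<le> f (x $ k)" "N x ^ 2 \<le> f (x $ k) ^ 2"
    using assms(2) nonneg[of x] by (auto simp: profile_body_def intro: power_mono)
  then have "norm x ^ 2 \<le> R ^ 2"
    using assms(1) dominates[of x] unfolding elongated_def by (smt (verit))
  then show ?thesis using assms(1) by (simp add: elongated_def power2_le_iff_abs_le)
qed

lemma norm_eq_elongation:
  assumes "elongated R f" "x \<in> profile_body N k f" "norm x = R"
  shows "x = axis k R \<or> x = axis k (- R)"
proof -
  have f: "0 \<le> f (x $ k)" "N x ^ 2 \<le> f (x $ k) ^ 2"
    using assms(2) nonneg[of x] by (auto simp: profile_body_def intro: power_mono)
  then have "(x $ k) ^ 2 + f (x $ k) ^ 2 \<ge> R ^ 2"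
    using dominates[of x] unfolding assms(3) by linarith
  moreover have "(x $ k) ^ 2 + f (x $ k) ^ 2 \<le> R ^ 2"
    using assms(1) f(1) by (auto simp: elongated_def)
  ultimately have xk: "(x $ k)^2 = R^2"
    using assms(1) f(1) by (auto simp: elongated_def)
  then have "(norm x)^2 = (x $ k)^2"
    unfolding assms(3) by simp
  then have "(\<Sum>i\<in>UNIV - {k}. (x $ i)^2) = 0"
    using norm_power2_minus_component[of x k] by simp
  then have "x $ i = 0" if "i \<noteq> k" for i
    using that by (subst (asm) sum_nonneg_eq_0_iff) auto
  then have "x = axis k (x $ k)"
    by (auto simp: vec_eq_iff axis_def)
  then show ?thesis using xk by (metis power2_eq_iff)
qed

text \<open>
  The poles \<open>\<plusminus>R e\<^sub>k\<close> have distance \<open>2R\<close>, and in the target only the poles are that far apart, so \<open>T\<close>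
  permutes the poles. As distances to the poles are preserved, \<open>T\<close> preserves norms, and it preserves
  heights up to a sign \<open>\<sigma>\<close>. A point of the first body at height \<open>h\<close> that is farthest from the
  axis therefore goes to a point at height \<open>\<sigma> h\<close> with the same distance \<open>f h\<close> from the axis.
\<close>
lemma isometry_profile_le:
  assumes K: "elongated R f" and L: "elongated R g"
    and pole: "f R = 0" "f (- R) = 0"
    and T: "isometry T" "T ` profile_body N k f = profile_body N k g"
  shows "\<exists>\<sigma>\<in>{1,-1}. \<forall>h. f h \<ge> 0 \<longrightarrow> f h \<le> g (\<sigma> * h)"
proof -
  let ?K = "profile_body N k f" and ?L = "profile_body N k g"
  let ?p = "axis k R :: real^'n"
  have R: "R > 0" using K by (simp add: elongated_def)
  have Tin: "T x \<in> ?L" if "x \<in> ?K" for x using T(2) that by blast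
  have dT: "norm (T x - T y) = norm (x - y)" for x y
    using T(1) by (simp add: isometry_def dist_norm)
  have N_axis: "N (axis k h) = 0" for h
    using on_plane[of h 0] by (simp add: axis_def vec_eq_iff zero_vec_def[symmetric] cong: if_cong)
  have minus_p: "- ?p = axis k (- R)" by (auto simp: vec_eq_iff axis_def)
  have p: "?p \<in> ?K" "- ?p \<in> ?K"
    using pole unfolding minus_p by (simp_all add: profile_body_def N_axis)
  have np: "norm ?p = R" using R by (simp add: norm_eq_sqrt_inner inner_axis_axis)
  have le: "norm (T ?p) \<le> R" "norm (T (- ?p)) \<le> R"
    using norm_le_elongation[OF L] Tin p by auto
  have dist: "norm (T ?p - T (- ?p)) = 2 * R"
    using np by (simp add: dT flip: scaleR_2)
  then have eq: "norm (T ?p) = R" "norm (T (- ?p)) = R"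
    using le norm_triangle_ineq4[of "T ?p" "T (- ?p)"] by auto
  then have cases: "T ?p = ?p \<or> T ?p = - ?p" "T (- ?p) = ?p \<or> T (- ?p) = - ?p"
    using norm_eq_elongation[OF L] Tin p unfolding minus_p by blast+
  have "T ?p \<noteq> T (- ?p)" using dist R by auto
  with cases obtain \<sigma> :: real where \<sigma>: "\<sigma> \<in> {1,-1}" "T ?p = \<sigma> *\<^sub>R ?p" "T (- ?p) = - (\<sigma> *\<^sub>R ?p)"
    by (metis insertI1 insertI2 minus_minus scaleR_minus1_left scaleR_one)
  have "f h \<le> g (\<sigma> * h)" if h: "f h \<ge> 0" for h
  proof -
    define x where "x = axis k h + axis j (f h)"
    have "x \<in> ?K" using on_plane h jk by (simp add: profile_body_def x_def axis_def)
    then have Tx: "N (T x) \<le> g (T x $ k)" using Tin by (force simp: profile_body_def)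
    have "norm (T x - \<sigma> *\<^sub>R ?p) ^ 2 = norm (x - ?p) ^ 2" "norm (T x + \<sigma> *\<^sub>R ?p) ^ 2 = norm (x + ?p) ^ 2"
      using dT[of x ?p] dT[of x "- ?p"] \<sigma> by simp_all
    moreover have "norm (\<sigma> *\<^sub>R ?p) = norm ?p" using \<sigma>(1) by auto
    ultimately have nx: "norm (T x) ^ 2 = norm x ^ 2" and ip: "T x \<bullet> (\<sigma> *\<^sub>R ?p) = x \<bullet> ?p"
      using norm_inner_eq_if_norm_diff_add_eq by metis+
    have "x $ k = h" using jk by (simp add: x_def axis_def)
    then have "\<sigma> * (T x $ k) * R = h * R"
      using ip by (simp add: inner_axis)
    then have "\<sigma> * (T x $ k) = h" using R by simp
    then have Tk: "T x $ k = \<sigma> * h" using \<sigma>(1) by auto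
    have "norm x ^ 2 = h ^ 2 + f h ^ 2"
      using jk unfolding x_def power2_norm_eq_inner
      by (simp add: inner_add inner_axis_axis power2_eq_square)
    moreover have "(\<sigma> * h)^2 = h^2" using \<sigma>(1) by auto
    ultimately have "f h ^ 2 \<le> N (T x) ^ 2"
      using dominates[of "T x"] nx Tk by simp
    then have "f h \<le> N (T x)"
      using nonneg power2_le_imp_le by blast
    then show ?thesis using Tx Tk by simp
  qed
  then show ?thesis using \<sigma>(1) by blast
qed

text \<open>
  The profiles \<open>a\<close> and \<open>b\<close> come from the even profile \<open>f\<^sub>0\<close> by two dents that do not
  overlap, even after one of them is reflected. The heights \<open>u\<close> and \<open>v\<close> exclude the two possible signs in
  the preceding lemma.
\<close>
proposition noncongruent_slab_pair_profile_bodies: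
  fixes f\<^sub>0 a b f g :: "real \<Rightarrow> real"
  assumes f_def: "f = (\<lambda>h. min (a h) (b h))" and g_def: "g = (\<lambda>h. min (a h) (b (- h)))"
    and a: "continuous_on UNIV a" and b: "continuous_on UNIV b"
    and f0: "\<And>h. max (a h) (b h) = f\<^sub>0 h" and f0': "\<And>h. max (a h) (b (- h)) = f\<^sub>0 h"
    and elong: "elongated R f\<^sub>0"
    and pole: "f R = 0" "f (- R) = 0"
    and cvx: "convex (profile_body N k f\<^sub>0)" "convex (profile_body N k f)" "convex (profile_body N k g)"
    and ball: "\<And>x. norm x \<le> t \<Longrightarrow> N x < f (x $ k)" "\<And>x. norm x \<le> t \<Longrightarrow> N x < g (x $ k)" and t: "t > 0"
    and beyond: "f u \<ge> 0" "f u > g u" "f v \<ge> 0" "f v > g (- v)"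
  shows "noncongruent_slab_pair t (profile_body N k f) (profile_body N k g)"
proof -
  let ?A = "profile_body N k a" and ?B = "profile_body N k b"
  let ?K = "profile_body N k f" and ?L = "profile_body N k g"
  have le: "a h \<le> f\<^sub>0 h" "b h \<le> f\<^sub>0 h" for h using f0[of h] by auto
  have el: "elongated R a" "elongated R b" "elongated R f" "elongated R g"
    using le by (auto simp: f_def g_def min_le_iff_disj intro!: elongated_mono[OF elong])
  have compact: "compact (profile_body N k q)" if "elongated R q" "continuous_on UNIV q" for q
    using norm_le_elongation[OF that(1)] closed_profile_body[OF that(2)]
    by (auto simp: compact_eq_bounded_closed bounded_iff)
  have b': "continuous_on UNIV (\<lambda>h. b (- h))"
    by (rule continuous_on_compose2[OF b]) (auto intro!: continuous_intros)
  have fg: "continuous_on UNIV f" "continuous_on UNIV g"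
    unfolding f_def g_def using a b b' by (auto intro!: continuous_on_min)
  have K: "?K = ?A \<inter> ?B" and L: "?L = ?A \<inter> uminus ` ?B"
    by (simp_all add: f_def g_def profile_body_Int uminus_profile_body minus)
  have AB: "?A \<union> ?B = profile_body N k f\<^sub>0" "?A \<union> uminus ` ?B = profile_body N k f\<^sub>0"
    by (simp_all add: uminus_profile_body minus profile_body_Un f0 f0')
  have int: "cball 0 t \<subseteq> interior (profile_body N k q)"
    if "continuous_on UNIV q" "\<And>x. norm x \<le> t \<Longrightarrow> N x < q (x $ k)" for q
    using that by (intro subset_trans[OF _ interior_maximal[OF _ open_profile_interior[OF that(1)]]])
       (auto simp: profile_body_def)
  have intK: "cball 0 t \<subseteq> interior ?K" and intL: "cball 0 t \<subseteq> interior ?L"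
    using int fg ball by auto
  then have "interior ?K \<noteq> {}" "interior ?L \<noteq> {}"
    using t by (metis cball_eq_empty le_zero_eq not_less subset_empty less_imp_le)+
  then have body: "convex_body ?K" "convex_body ?L"
    using compact el fg cvx by (auto simp: convex_body_def)
  have "\<not> congruent_sets ?K ?L"
  proof
    assume "congruent_sets ?K ?L"
    then obtain \<sigma> where "\<sigma> \<in> {1::real,-1}" "\<And>h. f h \<ge> 0 \<Longrightarrow> f h \<le> g (\<sigma> * h)"
      using isometry_profile_le[OF el(3,4) pole] unfolding congruent_sets_def by blast
    then show False using beyond by force
  qed
  moreover have "intrinsic_volume i (?K \<inter> slab t \<xi>) = intrinsic_volume i (?L \<inter> slab t \<xi>)" for i \<xi>
    unfolding K L using compact el a b cvx AB
    by (intro intrinsic_volume_slab_section_reflect_cut) simp_all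
  ultimately show ?thesis
    using body intK intL by (simp add: noncongruent_slab_pair_def)
qed

end

section \<open>Polytopes\<close>

definition l1_off :: "'n \<Rightarrow> real^'n::finite \<Rightarrow> real" where
  "l1_off k x = (\<Sum>i\<in>UNIV - {k}. \<bar>x $ i\<bar>)"

lemma sum_power2_le_power2_sum:
  fixes f :: "'a \<Rightarrow> real"
  assumes "finite A" "\<And>i. i \<in> A \<Longrightarrow> f i \<ge> 0"
  shows "(\<Sum>i\<in>A. (f i)^2) \<le> (\<Sum>i\<in>A. f i)^2"
  using assms
proof (induction A rule: finite_induct)
  case (insert a A)
  then have "0 \<le> f a * sum f A" by (simp add: sum_nonneg)
  then show ?case using insert by (simp add: power2_sum)
qed simp

lemma profile_gauge_l1_off:
  assumes "j \<noteq> k"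
  shows "profile_gauge (l1_off k) k j"
proof
  show "continuous_on UNIV (l1_off k)"
    unfolding l1_off_def by (intro continuous_intros)
  show "norm x ^ 2 - (x $ k)^2 \<le> (l1_off k x)^2" for x
    unfolding norm_power2_minus_component l1_off_def
    using sum_power2_le_power2_sum[of "UNIV - {k}" "\<lambda>i. \<bar>x $ i\<bar>"] by simp
  show "l1_off k (axis k h + axis j s) = \<bar>s\<bar>" for h s
  proof -
    have "l1_off k (axis k h + axis j s) = (\<Sum>i\<in>UNIV - {k}. if i = j then \<bar>s\<bar> else 0)"
      unfolding l1_off_def by (intro sum.cong) (auto simp: axis_def)
    then show ?thesis using assms by simp
  qed
qed (use assms in \<open>auto simp: l1_off_def sum_nonneg\<close>)

lemma l1_off_le_card_times_norm: "l1_off k x \<le> CARD('n) * norm x" for x :: "real^'n::finite"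
proof -
  have "l1_off k x \<le> (\<Sum>i\<in>UNIV. \<bar>x $ i\<bar>)"
    unfolding l1_off_def by (intro sum_mono2) auto
  also have "\<dots> \<le> (\<Sum>i\<in>(UNIV::'n set). norm x)"
    by (intro sum_mono component_le_norm_cart)
  finally show ?thesis by simp
qed

text \<open>
  The inequality \<open>\<Sum>\<^sub>i \<bar>x\<^sub>i\<bar> \<le> a + b h\<close> is equivalent to the finitely many linear inequalities in which the
  absolute values are replaced by signs.
\<close>
lemma polyhedron_profile_body_affine:
  fixes k :: "'n::finite"
  shows "polyhedron (profile_body (l1_off k) k (\<lambda>h. a + b * h))"
proof -
  let ?\<Sigma> = "UNIV \<rightarrow>\<^sub>E {1, -1::real} :: ('n \<Rightarrow> real) set"
  let ?H = "\<lambda>\<sigma> :: 'n \<Rightarrow> real. {x. (\<chi> i. if i = k then - b else \<sigma> i) \<bullet> x \<le> a}"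
  have form: "(\<chi> i. if i = k then - b else \<sigma> i) \<bullet> x = (\<Sum>i\<in>UNIV - {k}. \<sigma> i * x $ i) - b * x $ k"
    for \<sigma> and x :: "real^'n"
    unfolding inner_vec_def by (subst sum.remove[of UNIV k]) (auto intro!: sum.cong)
  have "profile_body (l1_off k) k (\<lambda>h. a + b * h) = (\<Inter>\<sigma>\<in>?\<Sigma>. ?H \<sigma>)"
  proof (intro set_eqI iffI)
    fix x assume x: "x \<in> profile_body (l1_off k) k (\<lambda>h. a + b * h)"
    show "x \<in> (\<Inter>\<sigma>\<in>?\<Sigma>. ?H \<sigma>)"
    proof
      fix \<sigma> assume "\<sigma> \<in> ?\<Sigma>"
      then have "\<sigma> i \<in> {1,-1}" for i by auto
      then have "\<sigma> i * x $ i \<le> \<bar>x $ i\<bar>" for i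
        by (metis abs_ge_minus_self abs_ge_self insertE mult_1 mult_minus1 singletonD)
      then have "(\<Sum>i\<in>UNIV - {k}. \<sigma> i * x $ i) \<le> l1_off k x"
        unfolding l1_off_def by (intro sum_mono)
      then show "x \<in> ?H \<sigma>" using x by (simp add: form profile_body_def)
    qed
  next
    fix x assume x: "x \<in> (\<Inter>\<sigma>\<in>?\<Sigma>. ?H \<sigma>)"
    define \<sigma> where "\<sigma> i = (if x $ i \<ge> 0 then 1 else - 1 :: real)" for i
    have "\<sigma> \<in> ?\<Sigma>" by (auto simp: \<sigma>_def)
    then have "x \<in> ?H \<sigma>" using x by blast
    moreover have "(\<Sum>i\<in>UNIV - {k}. \<sigma> i * x $ i) = l1_off k x"
      unfolding l1_off_def by (intro sum.cong) (auto simp: \<sigma>_def)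
    ultimately show "x \<in> profile_body (l1_off k) k (\<lambda>h. a + b * h)"
      by (simp add: form profile_body_def)
  qed
  moreover have "polyhedron (\<Inter>\<sigma>\<in>?\<Sigma>. ?H \<sigma>)"
    by (intro polyhedron_Inter finite_imageI finite_PiE) (auto simp: polyhedron_halfspace_le)
  ultimately show ?thesis by simp
qed

text \<open>
  The graph of \<open>roof s\<close> has slopes \<open>0\<close>, \<open>\<mp>1/4\<close> and \<open>\<mp>1/2\<close>, corners at the heights \<open>\<plusminus>4s\<close> (value \<open>2s\<close>) and
  \<open>\<plusminus>8s\<close> (value \<open>s\<close>), and it reaches zero at the poles \<open>\<plusminus>10s\<close>. The lines \<open>inner_cut s\<close> and \<open>outer_cut s\<close>
  pass \<open>s/8\<close> below the corners at \<open>4s\<close> and \<open>8s\<close>; their slopes are the means of the adjacent ones, so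
  that they cut off these corners between \<open>3s\<close> and \<open>5s\<close> and between \<open>7s\<close> and \<open>9s\<close>.
\<close>
definition roof :: "real \<Rightarrow> real \<Rightarrow> real" where
  "roof s h = min (2 * s) (min (min (3 * s + - (1/4) * h) (3 * s + 1/4 * h))
     (min (5 * s + - (1/2) * h) (5 * s + 1/2 * h)))"

definition inner_cut :: "real \<Rightarrow> real \<Rightarrow> real" where
  "inner_cut s h = 19/8 * s + - (1/8) * h"

definition outer_cut :: "real \<Rightarrow> real \<Rightarrow> real" where
  "outer_cut s h = 31/8 * s + - (3/8) * h"

text \<open>
  The roof lies below its last pieces, so \<open>w = roof s h\<close> satisfies \<open>2w \<le> R - \<bar>h\<bar>\<close> with \<open>R = 10s\<close>. Hence
  \<open>4 (R\<^sup>2 - h\<^sup>2 - w\<^sup>2) \<ge> (R - \<bar>h\<bar>) (3R + 5\<bar>h\<bar>)\<close> where \<open>w \<ge> 0\<close>, and the right-hand side vanishes only at the poles.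
\<close>
lemma elongated_roof:
  assumes "s > 0"
  shows "elongated (10 * s) (roof s)"
  unfolding elongated_def
proof (intro conjI allI impI)
  show "10 * s > 0" using assms by simp
  fix h assume h: "0 \<le> roof s h"
  define R where "R = 10 * s"
  have R: "R > 0" using assms by (simp add: R_def)
  from h have r: "2 * roof s h \<le> R - \<bar>h\<bar>"
    unfolding R_def by (auto simp: roof_def min_def abs_if)
  have h': "\<bar>h\<bar> \<le> R" using r h by simp
  have eq: "4 * (R^2 - (h^2 + (roof s h)^2)) =
      ((R - \<bar>h\<bar>)^2 - (2 * roof s h)^2) + (R - \<bar>h\<bar>) * (3 * R + 5 * \<bar>h\<bar>)"
    by (simp add: power2_eq_square algebra_simps)
  have p1: "(2 * roof s h)^2 \<le> (R - \<bar>h\<bar>)^2"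
    using r h by (intro power_mono) auto
  have p2: "0 \<le> (R - \<bar>h\<bar>) * (3 * R + 5 * \<bar>h\<bar>)"
    using h' R by simp
  show "h\<^sup>2 + (roof s h)\<^sup>2 \<le> (10 * s)\<^sup>2"
  proof -
    have "0 \<le> 4 * (R^2 - (h^2 + (roof s h)^2))"
      unfolding eq using p1 p2 by (intro add_nonneg_nonneg) simp_all
    then show ?thesis unfolding R_def by simp
  qed
  show "h\<^sup>2 = (10 * s)\<^sup>2" if "h\<^sup>2 + (roof s h)\<^sup>2 = (10 * s)\<^sup>2"
    using that unfolding R_def[symmetric]
  proof -
    assume "h\<^sup>2 + (roof s h)\<^sup>2 = R\<^sup>2"
    then have "((R - \<bar>h\<bar>)^2 - (2 * roof s h)^2) + (R - \<bar>h\<bar>) * (3 * R + 5 * \<bar>h\<bar>) = 0"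
      unfolding eq[symmetric] by simp
    then have "(R - \<bar>h\<bar>) * (3 * R + 5 * \<bar>h\<bar>) = 0"
      using p1 p2 by (subst (asm) add_nonneg_eq_0_iff) simp_all
    then have "\<bar>h\<bar> = R" using R by auto
    then show "h\<^sup>2 = R\<^sup>2" by (metis power2_abs)
  qed
qed

lemma roof_le:
  "roof s h \<le> 2 * s" "roof s h \<le> 3 * s + - (1/4) * h" "roof s h \<le> 3 * s + 1/4 * h"
  "roof s h \<le> 5 * s + - (1/2) * h" "roof s h \<le> 5 * s + 1/2 * h"
  unfolding roof_def by (blast intro: min.coboundedI1 min.coboundedI2 order_refl)+

text \<open>
  The two cuts do not overlap, on the same side or on opposite sides.
\<close>
lemma roof_le_max_cuts:
  assumes "s > 0"
  shows "roof s h \<le> max (inner_cut s h) (outer_cut s h)"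
    and "roof s h \<le> max (inner_cut s h) (outer_cut s (- h))"
  using assms roof_le[of s h] unfolding inner_cut_def outer_cut_def by linarith+

lemma max_min_min_left: "max (min r a) (min r b) = r" if "r \<le> max a b" for r :: real
  using that by linarith

proposition polytope_noncongruent_slab_pair:
  assumes n: "CARD('n::finite) \<ge> 2" and t: "t > 0"
  shows "\<exists>K L :: (real^'n) set. noncongruent_slab_pair t K L \<and> polytope K \<and> polytope L"
proof -
  obtain k j :: 'n where "j \<noteq> k"
    by (rule two_coordinates[OF n])
  then interpret profile_gauge "l1_off k" k j by (rule profile_gauge_l1_off)
  \<comment> \<open>On the ball of radius \<open>t\<close> the \<open>\<ell>\<^sub>1\<close>-length is at most \<open>s\<close>, which is below the roof.\<close>
  define s where "s = CARD('n) * t"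
  have ts: "t \<le> s" "0 < s" using n t by (simp_all add: s_def)
  define a where "a h = min (roof s h) (inner_cut s h)" for h
  define b where "b h = min (roof s h) (outer_cut s h)" for h
  have even: "roof s (- h) = roof s h" for h by (simp add: roof_def min.commute)
  define f where "f = (\<lambda>h. min (a h) (b h))"
  define g where "g = (\<lambda>h. min (a h) (b (- h)))"
  let ?P = "\<lambda>f. profile_body (l1_off k) k f"
  have roof: "polyhedron (?P (roof s))"
    using polyhedron_profile_body_affine[of k "2 * s" 0]
    unfolding roof_def profile_body_Int[symmetric]
    by (intro polyhedron_Int polyhedron_profile_body_affine) simp
  have "polyhedron (?P (inner_cut s))" "polyhedron (?P (outer_cut s))"
    unfolding inner_cut_def[abs_def] outer_cut_def[abs_def] by (rule polyhedron_profile_body_affine)+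
  moreover have "polyhedron (?P (\<lambda>h. outer_cut s (- h)))"
    using polyhedron_profile_body_affine[of k "31/8 * s" "3/8"] by (simp add: outer_cut_def)
  ultimately have "polyhedron (?P a)" "polyhedron (?P b)" "polyhedron (?P (\<lambda>h. b (- h)))"
    using roof unfolding a_def[abs_def] b_def[abs_def] even profile_body_Int[symmetric]
    by (simp_all add: polyhedron_Int)
  then have poly: "polyhedron (?P f)" "polyhedron (?P g)"
    unfolding f_def g_def profile_body_Int[symmetric] by simp_all
  have le: "f h \<le> roof s h" "g h \<le> roof s h" for h
    by (auto simp: f_def g_def a_def)
  have polytope: "polytope (?P q)" if "polyhedron (?P q)" "\<And>h. q h \<le> roof s h" for q
    using that norm_le_elongation[OF elongated_mono[OF elongated_roof[OF ts(2)] that(2)]]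
    by (auto simp: polytope_eq_bounded_polyhedron bounded_iff)
  have in_ball: "l1_off k x < 3/2 * s" "\<bar>x $ k\<bar> \<le> s" if "norm x \<le> t" for x
  proof -
    have "CARD('n) * norm x \<le> s" using that by (simp add: s_def)
    then show "l1_off k x < 3/2 * s"
      using l1_off_le_card_times_norm[of k x] ts(2) by linarith
    show "\<bar>x $ k\<bar> \<le> s" using that component_le_norm_cart[of x k] ts(1) by linarith
  qed
  have low: "3/2 * s \<le> f h" "3/2 * s \<le> g h" if "\<bar>h\<bar> \<le> s" for h
  proof -
    have "- s \<le> h" "h \<le> s" using that by auto
    then show "3/2 * s \<le> f h" "3/2 * s \<le> g h"
      unfolding f_def g_def a_def b_def even unfolding roof_def inner_cut_def outer_cut_def
      by (intro min.boundedI; linarith)+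
  qed
  have "noncongruent_slab_pair t (?P f) (?P g)"
  \<comment> \<open>At height \<open>-8s\<close> the first body keeps its corner and the second has lost it; if heights
    are reversed, the same happens for the corner at \<open>-4s\<close> and its reflection at \<open>4s\<close>.\<close>
  proof (rule noncongruent_slab_pair_profile_bodies[where a = a and b = b and f\<^sub>0 = "roof s"
        and R = "10 * s" and u = "- 8 * s" and v = "- 4 * s"])
    show "continuous_on UNIV a" "continuous_on UNIV b"
      unfolding a_def b_def roof_def inner_cut_def outer_cut_def by (intro continuous_intros)+
    show "max (a h) (b h) = roof s h" "max (a h) (b (- h)) = roof s h" for h
      unfolding a_def b_def even using roof_le_max_cuts[OF ts(2)] max_min_min_left by blast+
    show "convex (?P (roof s))" "convex (?P f)" "convex (?P g)"
      using roof poly polyhedron_imp_convex by blast+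
    show "l1_off k x < f (x $ k)" "l1_off k x < g (x $ k)" if "norm x \<le> t" for x
      using in_ball[OF that] low[OF in_ball(2)[OF that]] by linarith+
    have "roof s (10 * s) = 0" "roof s (8 * s) = s" "roof s (4 * s) = 2 * s"
      using ts(2) by (simp_all add: roof_def min_def)
    then have "f (10 * s) = 0" "f (- (10 * s)) = 0" "f (- 8 * s) = s" "g (- 8 * s) = 7/8 * s"
        "f (- 4 * s) = 2 * s" "g (4 * s) = 15/8 * s"
      using ts(2) even[of "10 * s"] even[of "8 * s"] even[of "4 * s"]
      unfolding a_def b_def f_def g_def inner_cut_def outer_cut_def
      by (simp_all add: min_absorb1 min_absorb2)
    then show "f (10 * s) = 0" "f (- (10 * s)) = 0" "f (- 8 * s) \<ge> 0" "g (- 8 * s) < f (- 8 * s)"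
        "f (- 4 * s) \<ge> 0" "g (- (- 4 * s)) < f (- 4 * s)"
      using ts(2) by simp_all
  qed (use ts t elongated_roof f_def g_def in simp_all)
  then show ?thesis
    using polytope[OF poly(1) le(1)] polytope[OF poly(2) le(2)] by blast
qed

section \<open>Smooth functions\<close>

lemma has_derivative_frechet_derivative:
  "f differentiable (at x) \<Longrightarrow> (f has_derivative frechet_derivative f (at x)) (at x)"
  by (simp add: frechet_derivative_works)

lemma Ck_on_cong:
  assumes "open U" "\<And>x. x \<in> U \<Longrightarrow> f x = g x" "Ck_on k U f"
  shows "Ck_on k U g"
  using assms(2,3)
proof (induction k arbitrary: f g)
  case 0
  then show ?case by (simp cong: continuous_on_cong)
next
  case (Suc k)
  have der: "(g has_derivative frechet_derivative f (at x)) (at x)" if "x \<in> U" for x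
  proof (rule has_derivative_transform_within_open[OF _ assms(1) that Suc.prems(1)])
    show "(f has_derivative frechet_derivative f (at x)) (at x)"
      using Suc.prems(2) that by (simp add: has_derivative_frechet_derivative)
  qed
  have "Ck_on k U (\<lambda>x. frechet_derivative g (at x) v)" for v
  proof (rule Suc.IH)
    show "frechet_derivative f (at x) v = frechet_derivative g (at x) v" if "x \<in> U" for x
      by (rule fun_cong[OF frechet_derivative_at[OF der[OF that]]])
    show "Ck_on k U (\<lambda>x. frechet_derivative f (at x) v)"
      using Suc.prems(2) by simp
  qed
  then show ?case using der by (auto simp: differentiable_def)
qed

text \<open>
  This rule allows any family of derivatives in place of \<open>frechet_derivative\<close>; the closure properties
  below then follow by induction on the order from the usual rules of differentiation.
\<close>
lemma Ck_on_SucI: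
  assumes "open U" "\<And>x. x \<in> U \<Longrightarrow> (f has_derivative f' x) (at x)" "\<And>v. Ck_on k U (\<lambda>x. f' x v)"
  shows "Ck_on (Suc k) U f"
proof -
  have "Ck_on k U (\<lambda>x. frechet_derivative f (at x) v)" for v
    by (rule Ck_on_cong[OF assms(1) _ assms(3)[of v]])
      (rule fun_cong[OF frechet_derivative_at[OF assms(2)]])
  then show ?thesis using assms(2) by (auto simp: differentiable_def)
qed

lemma Ck_on_has_derivative:
  assumes "Ck_on (Suc k) U f" "x \<in> U"
  shows "(f has_derivative frechet_derivative f (at x)) (at x)"
  using assms by (auto intro: has_derivative_frechet_derivative)

lemma Ck_on_Suc_imp: "Ck_on (Suc k) U f \<Longrightarrow> Ck_on k U f"
proof (induction k arbitrary: f)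
  case 0
  then show ?case
    by (auto intro!: continuous_at_imp_continuous_on differentiable_imp_continuous_within)
next
  case (Suc k)
  show ?case
    using Suc.prems Suc.IH by simp
qed

lemma Ck_on_const: "open U \<Longrightarrow> Ck_on k U (\<lambda>x. c)"
proof (induction k arbitrary: c)
  case (Suc k)
  show ?case
    by (rule Ck_on_SucI[OF Suc.prems, where f' = "\<lambda>x v. 0"]) (auto intro: Suc)
qed auto

lemma Ck_on_bounded_linear:
  assumes "open U" "bounded_linear f"
  shows "Ck_on k U f"
proof (cases k)
  case 0
  then show ?thesis using linear_continuous_on[OF assms(2)] by simp
next
  case (Suc m)
  show ?thesis unfolding Suc
    by (rule Ck_on_SucI[OF assms(1), where f' = "\<lambda>x. f"])
       (auto intro: bounded_linear_imp_has_derivative assms Ck_on_const)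
qed

lemma Ck_on_add:
  assumes U: "open U"
  shows "Ck_on k U f \<Longrightarrow> Ck_on k U g \<Longrightarrow> Ck_on k U (\<lambda>x. f x + g x)"
proof (induction k arbitrary: f g)
  case 0
  then show ?case by (auto intro: continuous_on_add)
next
  case (Suc k)
  show ?case
    by (rule Ck_on_SucI[OF U has_derivative_add[OF Ck_on_has_derivative Ck_on_has_derivative]])
       (use Suc in auto)
qed

lemma Ck_on_bilinear:
  assumes U: "open U" and bil: "bounded_bilinear mul"
  shows "Ck_on k U f \<Longrightarrow> Ck_on k U g \<Longrightarrow> Ck_on k U (\<lambda>x. mul (f x) (g x))"
proof (induction k arbitrary: f g)
  case 0
  then show ?case using bounded_bilinear.continuous_on[OF bil] by auto
next
  case (Suc k)
  have "Ck_on k U (\<lambda>x. mul (f x) (frechet_derivative g (at x) v) + mul (frechet_derivative f (at x) v) (g x))" for v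
    using Suc Ck_on_Suc_imp[OF Suc.prems(1)] Ck_on_Suc_imp[OF Suc.prems(2)]
    by (intro Ck_on_add[OF U] Suc.IH) auto
  then show ?case
    by (intro Ck_on_SucI[OF U bounded_bilinear.FDERIV[OF bil Ck_on_has_derivative Ck_on_has_derivative]])
       (use Suc in auto)
qed

text \<open>
  For a real inner function, the chain rule expresses the derivative as a product of \<open>C\<^sup>k\<close> functions,
  because a linear map on \<open>\<real>\<close> is determined by its value at \<open>1\<close>.
\<close>
lemma Ck_on_compose_real:
  fixes g :: "real \<Rightarrow> real"
  assumes U: "open U" and V: "open V" and fU: "\<And>x. x \<in> U \<Longrightarrow> f x \<in> V"
  shows "Ck_on k V g \<Longrightarrow> Ck_on k U f \<Longrightarrow> Ck_on k U (\<lambda>x. g (f x))"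
proof (induction k arbitrary: g)
  case 0
  then show ?case using fU by (auto intro: continuous_on_compose2[of V])
next
  case (Suc k)
  have f: "Ck_on k U f" using Suc.prems Ck_on_Suc_imp by blast
  have lin: "frechet_derivative g (at y) w = w * frechet_derivative g (at y) 1" if "y \<in> V" for y w
  proof -
    have "linear (frechet_derivative g (at y))"
      using Suc.prems(1) that by (auto intro: linear_frechet_derivative)
    then show ?thesis using linear_scale[of "frechet_derivative g (at y)" w 1] by simp
  qed
  have prod: "Ck_on k U (\<lambda>x. frechet_derivative f (at x) v * frechet_derivative g (at (f x)) 1)" for v
  proof (rule Ck_on_bilinear[OF U bounded_bilinear_mult])
    show "Ck_on k U (\<lambda>x. frechet_derivative f (at x) v)" using Suc.prems(2) by simp
    show "Ck_on k U (\<lambda>x. frechet_derivative g (at (f x)) 1)" 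
      by (rule Suc.IH) (use Suc.prems(1) f in simp_all)
  qed
  have "Ck_on k U (\<lambda>x. frechet_derivative g (at (f x)) (frechet_derivative f (at x) v))" for v
    by (rule Ck_on_cong[OF U _ prod[of v]]) (rule lin[OF fU, symmetric])
  then show ?case
    by (intro Ck_on_SucI[OF U has_derivative_compose[OF Ck_on_has_derivative Ck_on_has_derivative]])
       (use Suc fU in auto)
qed

lemma smooth_on_const: "open U \<Longrightarrow> smooth_on U (\<lambda>x. c)"
  by (simp add: smooth_on_def Ck_on_const)

lemma smooth_on_bounded_linear: "open U \<Longrightarrow> bounded_linear f \<Longrightarrow> smooth_on U f"
  by (simp add: smooth_on_def Ck_on_bounded_linear)

lemma smooth_on_add:
  "open U \<Longrightarrow> smooth_on U f \<Longrightarrow> smooth_on U g \<Longrightarrow> smooth_on U (\<lambda>x. f x + g x)"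
  by (simp add: smooth_on_def Ck_on_add)

lemma smooth_on_mult:
  fixes f g :: "'a::real_normed_vector \<Rightarrow> real"
  shows "open U \<Longrightarrow> smooth_on U f \<Longrightarrow> smooth_on U g \<Longrightarrow> smooth_on U (\<lambda>x. f x * g x)"
  by (simp add: smooth_on_def Ck_on_bilinear[OF _ bounded_bilinear_mult])

lemma smooth_on_inner:
  "open U \<Longrightarrow> smooth_on U f \<Longrightarrow> smooth_on U g \<Longrightarrow> smooth_on U (\<lambda>x. f x \<bullet> g x)"
  by (simp add: smooth_on_def Ck_on_bilinear[OF _ bounded_bilinear_inner])

lemma smooth_on_scaleR:
  "open U \<Longrightarrow> smooth_on U f \<Longrightarrow> smooth_on U g \<Longrightarrow> smooth_on U (\<lambda>x. f x *\<^sub>R g x)"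
  by (simp add: smooth_on_def Ck_on_bilinear[OF _ bounded_bilinear_scaleR])

lemma smooth_on_minus:
  fixes f g :: "'a::real_normed_vector \<Rightarrow> real"
  assumes "open U" "smooth_on U f" "smooth_on U g"
  shows "smooth_on U (\<lambda>x. f x - g x)"
  using smooth_on_add[OF assms(1,2) smooth_on_mult[OF assms(1) smooth_on_const[OF assms(1), of "-1"] assms(3)]]
  by simp

lemma smooth_on_compose_real:
  fixes g :: "real \<Rightarrow> real"
  assumes "open U" "open V" "\<And>x. x \<in> U \<Longrightarrow> f x \<in> V" "smooth_on V g" "smooth_on U f"
  shows "smooth_on U (\<lambda>x. g (f x))"
  using assms by (simp add: smooth_on_def Ck_on_compose_real[of U V f])

text \<open>
  The functions \<open>c x\<^sup>s\<close> form a family that is closed under differentiation.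
\<close>
lemma smooth_on_sqrt: "smooth_on {0<..} sqrt"
proof -
  have "Ck_on m {0<..} (\<lambda>x::real. c * x powr s)" for m c s
  proof (induction m arbitrary: c s)
    case 0
    show ?case by (auto intro!: continuous_intros)
  next
    case (Suc m)
    have "((\<lambda>x. c * x powr s) has_derivative (*) (c * (s * x powr (s - 1)))) (at x)"
      if "x \<in> {0<..}" for x
      using DERIV_cmult[OF has_real_derivative_powr[of x s], of c] that
      by (simp add: has_field_derivative_def)
    moreover have "Ck_on m {0<..} (\<lambda>x::real. c * (s * x powr (s - 1)) * v)" for v
      using Suc[of "v * (c * s)" "s - 1"] by (simp add: mult_ac)
    ultimately show ?case by (intro Ck_on_SucI) auto
  qed
  note power = this
  have "Ck_on m {0<..} sqrt" for m
    by (rule Ck_on_cong[OF _ _ power[of m 1 "1/2"]]) (simp_all add: powr_half_sqrt)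
  then show ?thesis by (simp add: smooth_on_def)
qed

lemma smooth_on_real_derivative:
  fixes f :: "real \<Rightarrow> real"
  assumes "smooth_on UNIV f"
  obtains f' where "smooth_on UNIV f'" "\<And>x. (f has_real_derivative f' x) (at x)"
proof
  let ?f' = "\<lambda>x. frechet_derivative f (at x) 1"
  show "smooth_on UNIV ?f'"
    unfolding smooth_on_def
  proof
    fix k show "Ck_on k UNIV ?f'"
      using assms unfolding smooth_on_def by (metis Ck_on.simps(2))
  qed
  fix x
  have d: "(f has_derivative frechet_derivative f (at x)) (at x)"
    using assms Ck_on_has_derivative unfolding smooth_on_def by blast
  then have "frechet_derivative f (at x) = (*) (?f' x)"
  proof (intro ext)
    fix v show "frechet_derivative f (at x) v = ?f' x * v"
      using linear_scale[OF has_derivative_linear[OF d], of v 1] by (simp only: real_scaleR_def mult_1_right mult_1_left mult.commute)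
  qed
  then show "(f has_real_derivative ?f' x) (at x)"
    using d by (simp add: has_field_derivative_def)
qed

lemma Ck_on_subset: "Ck_on k V f \<Longrightarrow> U \<subseteq> V \<Longrightarrow> Ck_on k U f"
proof (induction k arbitrary: f)
  case 0
  then show ?case by (auto intro: continuous_on_subset)
next
  case (Suc k)
  then show ?case by (auto simp: subset_iff)
qed

lemma smooth_on_subset: "smooth_on V f \<Longrightarrow> U \<subseteq> V \<Longrightarrow> smooth_on U f"
  using Ck_on_subset unfolding smooth_on_def by blast

lemma smooth_on_continuous: "smooth_on U f \<Longrightarrow> continuous_on U f"
  unfolding smooth_on_def using Ck_on.simps(1) by blast

lemma smooth_on_component: "open U \<Longrightarrow> smooth_on U (\<lambda>x :: real^'n::finite. x $ i)"
  by (intro smooth_on_bounded_linear bounded_linear_vec_nth)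

section \<open>Bump functions with small second derivative\<close>

text \<open>
  For \<open>p = 1\<close> this is the standard smooth function all of whose derivatives vanish at \<open>0\<close>; general
  polynomials \<open>p\<close> make the family closed under differentiation.
\<close>
definition flat :: "real poly \<Rightarrow> real \<Rightarrow> real" where
  "flat p x = (if x > 0 then poly p (1 / x) * exp (- (1 / x)) else 0)"

lemma poly_times_exp_minus_tendsto_0: "((\<lambda>y::real. poly p y * exp (- y)) \<longlongrightarrow> 0) at_top"
proof -
  have "((\<lambda>y::real. \<Sum>i\<le>degree p. coeff p i * (y ^ i / exp y)) \<longlongrightarrow> (\<Sum>i\<le>degree p. coeff p i * 0)) at_top"
    by (intro tendsto_intros tendsto_power_div_exp_0)
  then show ?thesis
    by (simp add: poly_altdef sum_divide_distrib exp_minus field_simps)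
qed

lemma DERIV_flat:
  "(flat p has_real_derivative flat ([:0, 0, 1:] * (p - pderiv p)) x) (at x)"
proof -
  consider "x > 0" | "x < 0" | "x = 0" by linarith
  then show ?thesis
  proof cases
    case 1
    have "((\<lambda>x. poly p (1 / x) * exp (- (1 / x))) has_real_derivative
        flat ([:0, 0, 1:] * (p - pderiv p)) x) (at x)"
      using 1 by (auto intro!: derivative_eq_intros DERIV_chain2[OF poly_DERIV]
          simp: flat_def power2_eq_square field_simps)
    then show ?thesis
      by (rule has_field_derivative_transform_within_open[where S = "{0<..}"])
         (use 1 in \<open>auto simp: flat_def\<close>)
  next
    case 2
    have "((\<lambda>x. 0) has_real_derivative flat ([:0, 0, 1:] * (p - pderiv p)) x) (at x)"
      using 2 by (simp add: flat_def)
    then show ?thesis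
      by (rule has_field_derivative_transform_within_open[where S = "{..<0}"])
         (use 2 in \<open>auto simp: flat_def\<close>)
  next
    case 3
    have "((\<lambda>h. (flat p h - flat p 0) / h) \<longlongrightarrow> 0) (at_left 0)"
      by (rule tendsto_eventually) (auto simp: eventually_at_filter flat_def)
    moreover have "((\<lambda>h. (flat p h - flat p 0) / h) \<longlongrightarrow> 0) (at_right 0)"
    proof -
      have "((\<lambda>h::real. poly (pCons 0 p) (inverse h) * exp (- inverse h)) \<longlongrightarrow> 0) (at_right 0)"
        by (rule filterlim_compose[OF poly_times_exp_minus_tendsto_0 filterlim_inverse_at_top_right])
      moreover have "\<forall>\<^sub>F h in at_right 0. poly (pCons 0 p) (inverse h) * exp (- inverse h) = (flat p h - flat p 0) / h"
        by (auto simp: eventually_at_filter flat_def field_simps)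
      ultimately show ?thesis by (rule Lim_transform_eventually)
    qed
    ultimately show ?thesis
      using 3 by (auto simp: has_field_derivative_iff filterlim_split_at flat_def)
  qed
qed

lemma smooth_on_flat: "smooth_on UNIV (flat p)"
proof -
  have "Ck_on m UNIV (flat p)" for m p
  proof (induction m arbitrary: p)
    case 0
    show ?case
      using DERIV_flat by (auto intro!: DERIV_continuous_on)
  next
    case (Suc m)
    let ?q = "[:0, 0, 1:] * (p - pderiv p)"
    have "Ck_on m UNIV (\<lambda>x. flat ?q x * v)" for v
      by (intro Ck_on_bilinear[OF _ bounded_bilinear_mult] Suc Ck_on_const) auto
    then show ?case
      using DERIV_flat[of p] by (intro Ck_on_SucI) (auto simp: has_field_derivative_def)
  qed
  then show ?thesis by (simp add: smooth_on_def)
qed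

lemma DERIV_eq_0_if_locally_0:
  fixes f :: "real \<Rightarrow> real"
  assumes "(f has_real_derivative d) (at x)" "open S" "x \<in> S" "\<And>y. y \<in> S \<Longrightarrow> f y = 0"
  shows "d = 0"
proof -
  have "((\<lambda>x. 0) has_real_derivative d) (at x)"
    using assms by (intro has_field_derivative_transform_within_open[OF assms(1-3)]) auto
  then show ?thesis using DERIV_unique DERIV_const by blast
qed

text \<open>
  A function of the height that is added to the quadratic form of a spheroid in order to dent it: \<open>\<delta>\<close>
  bounds the function and its second derivative, and \<open>r\<close> bounds the heights at which the body is changed.
\<close>
definition dent :: "real \<Rightarrow> real \<Rightarrow> (real \<Rightarrow> real) \<Rightarrow> bool" where
  "dent r \<delta> \<phi> \<longleftrightarrow> smooth_on UNIV \<phi> \<and> (\<forall>h. 0 \<le> \<phi> h \<and> \<phi> h \<le> \<delta>) \<and> (\<forall>h. \<bar>h\<bar> \<ge> r \<longrightarrow> \<phi> h = 0) \<and>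
     (\<exists>\<phi>' \<phi>''. (\<forall>h. (\<phi> has_real_derivative \<phi>' h) (at h)) \<and> (\<forall>h. (\<phi>' has_real_derivative \<phi>'' h) (at h)) \<and>
        (\<forall>h. \<bar>\<phi>'' h\<bar> \<le> \<delta>))"

lemma dent_0: "dent r 0 (\<lambda>h. 0)"
  unfolding dent_def
  by (intro conjI exI[of _ "\<lambda>h. 0"]) (auto intro: smooth_on_const)

lemma dent_mono: "dent r \<delta> \<phi> \<Longrightarrow> \<delta> \<le> \<epsilon> \<Longrightarrow> dent r \<epsilon> \<phi>"
  unfolding dent_def by (meson order_trans)

lemma dent_add:
  assumes "dent r \<delta> \<phi>" "dent r \<epsilon> \<psi>"
  shows "dent r (\<delta> + \<epsilon>) (\<lambda>h. \<phi> h + \<psi> h)"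
proof -
  obtain \<phi>' \<phi>'' where \<phi>: "\<And>h. (\<phi> has_real_derivative \<phi>' h) (at h)"
      "\<And>h. (\<phi>' has_real_derivative \<phi>'' h) (at h)" "\<And>h. \<bar>\<phi>'' h\<bar> \<le> \<delta>"
    using assms(1) unfolding dent_def by blast
  obtain \<psi>' \<psi>'' where \<psi>: "\<And>h. (\<psi> has_real_derivative \<psi>' h) (at h)"
      "\<And>h. (\<psi>' has_real_derivative \<psi>'' h) (at h)" "\<And>h. \<bar>\<psi>'' h\<bar> \<le> \<epsilon>"
    using assms(2) unfolding dent_def by blast
  show ?thesis
    unfolding dent_def
  proof (intro conjI exI allI impI)
    show "smooth_on UNIV (\<lambda>h. \<phi> h + \<psi> h)"
      using assms unfolding dent_def by (intro smooth_on_add) auto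
    show "((\<lambda>h. \<phi> h + \<psi> h) has_real_derivative \<phi>' h + \<psi>' h) (at h)" for h
      by (intro DERIV_add \<phi> \<psi>)
    show "((\<lambda>h. \<phi>' h + \<psi>' h) has_real_derivative \<phi>'' h + \<psi>'' h) (at h)" for h
      by (intro DERIV_add \<phi> \<psi>)
    show "\<bar>\<phi>'' h + \<psi>'' h\<bar> \<le> \<delta> + \<epsilon>" for h
      using \<phi>(3)[of h] \<psi>(3)[of h] by linarith
  qed (use assms in \<open>auto simp: dent_def add_mono\<close>)
qed

lemma dent_reflect:
  assumes "dent r \<delta> \<phi>"
  shows "dent r \<delta> (\<lambda>h. \<phi> (- h))"
proof -
  obtain \<phi>' \<phi>'' where \<phi>: "\<And>h. (\<phi> has_real_derivative \<phi>' h) (at h)"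
      "\<And>h. (\<phi>' has_real_derivative \<phi>'' h) (at h)" "\<And>h. \<bar>\<phi>'' h\<bar> \<le> \<delta>"
    using assms unfolding dent_def by blast
  show ?thesis
    unfolding dent_def
  proof (intro conjI exI allI impI)
    have "smooth_on UNIV (uminus :: real \<Rightarrow> real)"
      by (intro smooth_on_bounded_linear bounded_linear_minus bounded_linear_ident open_UNIV)
    then show "smooth_on UNIV (\<lambda>h. \<phi> (- h))"
      using assms unfolding dent_def
      by (elim conjE) (rule smooth_on_compose_real[of UNIV UNIV uminus]; simp)
    show "((\<lambda>h. \<phi> (- h)) has_real_derivative - \<phi>' (- h)) (at h)" for h
      by (rule DERIV_mirror[THEN iffD1, OF \<phi>(1)])
    show "((\<lambda>h. - \<phi>' (- h)) has_real_derivative \<phi>'' (- h)) (at h)" for h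
      using DERIV_minus[OF DERIV_mirror[THEN iffD1, OF \<phi>(2)[of "- h"]]] by simp
    show "\<bar>\<phi>'' (- h)\<bar> \<le> \<delta>" for h by (rule \<phi>)
  qed (use assms in \<open>auto simp: dent_def\<close>)
qed

lemma zero_less_mult_pos_iff_pos: "(c::real) > 0 \<Longrightarrow> 0 < c * x \<longleftrightarrow> 0 < x"
  by (simp add: zero_less_mult_iff)

text \<open>
  The product of \<open>flat 1 (h - a)\<close> and \<open>flat 1 (b - h)\<close> is positive exactly between \<open>a\<close> and \<open>b\<close>. It has a bounded
  second derivative, since the support is compact, and can be scaled down.
\<close>
lemma bump_exists:
  assumes "a < b" "\<delta> > 0" "- r \<le> a" "b \<le> r"
  obtains \<beta> where "dent r \<delta> \<beta>" "\<And>h. 0 < \<beta> h \<longleftrightarrow> a < h \<and> h < b"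
proof -
  define \<gamma> where "\<gamma> h = flat 1 (h - a) * flat 1 (b - h)" for h
  have \<gamma>_pos: "0 < \<gamma> h \<longleftrightarrow> a < h \<and> h < b" and \<gamma>_nonneg: "0 \<le> \<gamma> h" for h
    by (auto simp: \<gamma>_def flat_def)
  have lin: "smooth_on UNIV (\<lambda>h. h - a)" "smooth_on UNIV (\<lambda>h. b - h)"
    by (intro smooth_on_minus smooth_on_const smooth_on_bounded_linear open_UNIV bounded_linear_ident)+
  then have "smooth_on UNIV \<gamma>"
    unfolding \<gamma>_def[abs_def]
    by (intro smooth_on_mult smooth_on_compose_real[OF open_UNIV open_UNIV _ smooth_on_flat] open_UNIV) auto
  then obtain \<gamma>' \<gamma>'' where \<gamma>: "smooth_on UNIV \<gamma>" "smooth_on UNIV \<gamma>''"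
      "\<And>x. (\<gamma> has_real_derivative \<gamma>' x) (at x)" "\<And>x. (\<gamma>' has_real_derivative \<gamma>'' x) (at x)"
    by (metis smooth_on_real_derivative)
  have cont: "continuous_on {a..b} \<gamma>" "continuous_on {a..b} \<gamma>''"
    using \<gamma>(1,2) Ck_on.simps(1) continuous_on_subset unfolding smooth_on_def by blast+
  obtain B C where B: "\<And>h. h \<in> {a..b} \<Longrightarrow> norm (\<gamma> h) \<le> B" and C: "\<And>h. h \<in> {a..b} \<Longrightarrow> norm (\<gamma>'' h) \<le> C"
    using compact_imp_bounded[OF compact_continuous_image[OF cont(1) compact_Icc]]
      compact_imp_bounded[OF compact_continuous_image[OF cont(2) compact_Icc]]
    unfolding bounded_iff by (metis imageI)
  define M where "M = max 1 (max B C)"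
  have M: "M > 0" by (simp add: M_def)
  have out: "\<gamma> h = 0" if "h \<in> - {a..b}" for h
    using that \<gamma>_pos[of h] \<gamma>_nonneg[of h] by auto
  have S: "open (- {a..b})" by (intro open_Compl closed_real_atLeastAtMost)
  have out': "\<gamma>' h = 0" if "h \<in> - {a..b}" for h
    using DERIV_eq_0_if_locally_0[OF \<gamma>(3) S that] out by blast
  have out'': "\<gamma>'' h = 0" if "h \<in> - {a..b}" for h
    using DERIV_eq_0_if_locally_0[OF \<gamma>(4) S that] out' by blast
  have bound: "\<gamma> h \<le> M" "\<bar>\<gamma>'' h\<bar> \<le> M" for h
    using B[of h] C[of h] out[of h] out''[of h] by (cases "h \<in> {a..b}"; auto simp: M_def)+
  let ?c = "\<delta> / M"
  have c: "?c > 0" using M assms by simp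
  have scale: "?c * y \<le> \<delta>" if "y \<le> M" for y
    using mult_left_mono[OF that, of ?c] c M by simp
  have "dent r \<delta> (\<lambda>h. ?c * \<gamma> h)"
    unfolding dent_def
  proof (intro conjI allI exI impI)
    show "smooth_on UNIV (\<lambda>h. ?c * \<gamma> h)"
      by (intro smooth_on_mult smooth_on_const \<gamma> open_UNIV)
    show "0 \<le> ?c * \<gamma> h" for h
      by (rule mult_nonneg_nonneg[OF less_imp_le[OF c] \<gamma>_nonneg])
    show "?c * \<gamma> h \<le> \<delta>" for h
      by (rule scale[OF bound(1)])
    show "?c * \<gamma> h = 0" if "\<bar>h\<bar> \<ge> r" for h
      using that assms(3,4) \<gamma>_pos[of h] \<gamma>_nonneg[of h] by auto
    show "((\<lambda>h. ?c * \<gamma> h) has_real_derivative ?c * \<gamma>' h) (at h)" for h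
      by (intro DERIV_cmult \<gamma>)
    show "((\<lambda>h. ?c * \<gamma>' h) has_real_derivative ?c * \<gamma>'' h) (at h)" for h
      by (intro DERIV_cmult \<gamma>)
    show "\<bar>?c * \<gamma>'' h\<bar> \<le> \<delta>" for h
      using scale[OF bound(2)] c by (simp only: abs_mult abs_of_pos)
  qed
  moreover have "(0 < ?c * \<gamma> h) = (a < h \<and> h < b)" for h
    unfolding \<gamma>_pos[symmetric] by (rule zero_less_mult_pos_iff_pos[OF c])
  ultimately show ?thesis by (rule that)
qed

section \<open>Curvature of convex level hypersurfaces\<close>

text \<open>
  The matrices on the segment from the identity to \<open>A\<close> are positive definite, hence invertible, so the
  determinant has no zero there and keeps the sign that it has at the identity.
\<close>
lemma det_pos_if_positive_definite:
  fixes A :: "real^'n::finite^'n"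
  assumes pos: "\<And>v. v \<noteq> 0 \<Longrightarrow> v \<bullet> (A *v v) > 0"
  shows "det A > 0"
proof (rule ccontr)
  assume neg: "\<not> det A > 0"
  define M :: "real \<Rightarrow> real^'n^'n" where "M s = (\<chi> i j. (1 - s) * (if i = j then 1 else 0) + s * A $ i $ j)" for s
  have "continuous_on {0..1} (\<lambda>s. det (M s))"
    unfolding det_def M_def by (auto intro!: continuous_intros)
  moreover have "M 0 = mat 1" "M 1 = A"
    by (simp_all add: M_def mat_def vec_eq_iff)
  ultimately obtain s where s: "0 \<le> s" "s \<le> 1" "det (M s) = 0"
    using IVT2'[of "\<lambda>s. det (M s)" 1 0 0] neg by (auto simp: det_I not_less)
  then have "\<not> invertible (M s)"
    by (simp add: invertible_det_nz)
  then obtain v where v: "v \<noteq> 0" "M s *v v = 0"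
    by (metis invertible_left_inverse matrix_left_invertible_ker)
  have "M s *v v = (1 - s) *\<^sub>R v + s *\<^sub>R (A *v v)"
    by (simp add: M_def vec_eq_iff matrix_vector_mult_def algebra_simps sum.distrib sum_distrib_left
        sum_subtractf mult_delta_right)
  then have "0 = (1 - s) * (v \<bullet> v) + s * (v \<bullet> (A *v v))"
    using v(2) by (metis inner_add_right inner_scaleR_right inner_zero_right)
  moreover have "0 < (1 - s) * (v \<bullet> v) + s * (v \<bullet> (A *v v))"
  proof (cases "s = 0")
    case False
    then show ?thesis using s pos[OF v(1)] by (intro add_nonneg_pos) auto
  qed (use v(1) in simp)
  ultimately show False by simp
qed

text \<open>
  \<open>G\<close> and \<open>H\<close> play the roles of the gradient and the Hessian of \<open>F\<close>. The tangent inequality makes \<open>G x\<close> a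
  subgradient at \<open>x\<close>, which gives convexity and the outer normals of the sublevel set.
\<close>
locale convex_sublevel =
  fixes F :: "real^'n::finite \<Rightarrow> real" and G :: "real^'n \<Rightarrow> real^'n" and H :: "real^'n \<Rightarrow> real^'n \<Rightarrow> real^'n"
    and c :: real
  assumes above_tangent: "F x + G x \<bullet> (y - x) \<le> F y"
    and cont_F: "continuous_on UNIV F"
    and gradient: "(G has_derivative H x) (at x)"
    and Hessian_pos: "v \<noteq> 0 \<Longrightarrow> v \<bullet> H x v > 0"
    and origin: "F 0 < c"
begin

definition sublevel :: "(real^'n) set" where "sublevel = {x. F x \<le> c}"

lemma convex_sublevel_set: "convex sublevel"
  unfolding convex_alt sublevel_def mem_Collect_eq
proof (intro ballI allI impI, unfold mem_Collect_eq)
  fix x y u assume F: "F x \<le> c" "F y \<le> c" and u: "0 \<le> u \<and> (u::real) \<le> 1"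
  let ?z = "(1 - u) *\<^sub>R x + u *\<^sub>R y"
  have "F ?z = (1 - u) * (F ?z + G ?z \<bullet> (x - ?z)) + u * (F ?z + G ?z \<bullet> (y - ?z))"
    by (simp add: inner_diff_right inner_add_right algebra_simps)
  also have "\<dots> \<le> (1 - u) * c + u * c"
    using u F order_trans[OF above_tangent F(1)] order_trans[OF above_tangent F(2)]
    by (intro add_mono mult_left_mono) auto
  finally show "F ?z \<le> c" by (simp add: algebra_simps)
qed

lemma closed_sublevel: "closed sublevel"
  unfolding sublevel_def by (intro closed_Collect_le cont_F continuous_intros)

lemma gradient_radial: "F x = c \<Longrightarrow> G x \<bullet> x > 0"
  using above_tangent[of x 0] origin by simp

lemma gradient_nonzero: "F x = c \<Longrightarrow> G x \<noteq> 0"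
  using gradient_radial by force

lemma frontier_sublevel: "frontier sublevel = {x. F x = c}"
proof -
  have "interior sublevel = {x. F x < c}"
  proof
    have "open {x. F x < c}"
      by (intro open_Collect_less cont_F continuous_intros)
    then show "{x. F x < c} \<subseteq> interior sublevel"
      by (intro interior_maximal) (auto simp: sublevel_def)
    show "interior sublevel \<subseteq> {x. F x < c}"
    proof
      fix x assume "x \<in> interior sublevel"
      then obtain e where e: "e > 0" "ball x e \<subseteq> sublevel" by (auto simp: mem_interior)
      show "x \<in> {x. F x < c}"
      proof (rule ccontr)
        assume "x \<notin> {x. F x < c}"
        moreover have "F x \<le> c" using e by (force simp: sublevel_def)
        ultimately have F: "F x = c" by simp
        then have x: "x \<noteq> 0" using origin by auto
        define s where "s = e / (2 * norm x)"
        have s: "s > 0" "s * norm x < e" using e x by (auto simp: s_def)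
        have "x + s *\<^sub>R x \<in> ball x e" using s by (simp add: dist_norm)
        then have "F (x + s *\<^sub>R x) \<le> c" using e by (auto simp: sublevel_def)
        moreover have "F (x + s *\<^sub>R x) \<ge> c + s * (G x \<bullet> x)"
          using above_tangent[of x "x + s *\<^sub>R x"] F by simp
        ultimately show False using gradient_radial[OF F] s(1) by (smt (verit) mult_pos_pos)
      qed
    qed
  qed
  then show ?thesis
    using closed_sublevel by (auto simp: frontier_def sublevel_def)
qed

text \<open>
  The tangent inequality shows that the normalised gradient is an outer normal. If \<open>u\<close> were another
  one, the direction \<open>d = u - sgn (G x)\<close> would have negative inner product with the gradient and positive inner
  product with \<open>u\<close>; a short step in direction \<open>d\<close> stays in the body but leaves the half-space of \<open>u\<close>.
\<close>
lemma outer_normal_eq: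
  assumes F: "F x = c"
  shows "outer_normal sublevel x = sgn (G x)"
  unfolding outer_normal_def
proof (rule the_equality)
  let ?\<nu> = "sgn (G x)"
  have N: "norm (G x) > 0" "norm ?\<nu> = 1" using gradient_nonzero[OF F] by (auto simp: norm_sgn)
  have G: "G x = norm (G x) *\<^sub>R ?\<nu>" using N by (simp add: sgn_div_norm)
  have "(y - x) \<bullet> ?\<nu> \<le> 0" if "y \<in> sublevel" for y
  proof -
    have "G x \<bullet> (y - x) \<le> 0" using above_tangent[of x y] that F by (simp add: sublevel_def)
    then show ?thesis
      using N(1) by (simp add: sgn_div_norm inner_commute mult_nonneg_nonpos)
  qed
  then show "norm ?\<nu> = 1 \<and> (\<forall>y\<in>sublevel. (y - x) \<bullet> ?\<nu> \<le> 0)" using N by blast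
  fix u assume u: "norm u = 1 \<and> (\<forall>y\<in>sublevel. (y - x) \<bullet> u \<le> 0)"
  show "u = ?\<nu>"
  proof (rule ccontr)
    assume ne: "u \<noteq> ?\<nu>"
    define d where "d = u - ?\<nu>"
    have "0 < d \<bullet> d" using ne by (simp add: d_def)
    moreover have uu: "u \<bullet> u = 1" "?\<nu> \<bullet> ?\<nu> = 1"
      using u N(2) by (simp_all add: power2_norm_eq_inner[symmetric])
    ultimately have less: "u \<bullet> ?\<nu> < 1"
      by (simp add: d_def inner_diff inner_commute)
    have du: "d \<bullet> u > 0" using less uu by (simp add: d_def inner_diff inner_commute)
    have "?\<nu> \<bullet> d < 0" using less uu by (simp add: d_def inner_diff inner_commute)
    then have Gd: "G x \<bullet> d < 0"
      by (subst G) (use N(1) in \<open>simp add: mult_pos_neg\<close>)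
    have cont_G: "continuous_on UNIV G"
      by (rule continuous_at_imp_continuous_on) (blast intro: has_derivative_continuous[OF gradient])
    have "continuous_on UNIV (\<lambda>s. x + s *\<^sub>R d)" by (intro continuous_intros)
    then have "continuous_on UNIV (\<lambda>s. G (x + s *\<^sub>R d))"
      by (rule continuous_on_compose2[OF cont_G]) simp
    then have "continuous_on UNIV (\<lambda>s. G (x + s *\<^sub>R d) \<bullet> d)"
      by (rule continuous_on_inner[OF _ continuous_on_const])
    then have "isCont (\<lambda>s. G (x + s *\<^sub>R d) \<bullet> d) 0"
      by (simp add: continuous_on_eq_continuous_at)
    then have "((\<lambda>s. G (x + s *\<^sub>R d) \<bullet> d) \<longlongrightarrow> G x \<bullet> d) (at 0)"
      by (simp add: isCont_def)
    then have "\<forall>\<^sub>F s in at 0. G (x + s *\<^sub>R d) \<bullet> d < 0"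
      using Gd by (rule order_tendstoD(2))
    then obtain \<epsilon> where \<epsilon>: "\<epsilon> > 0" "\<And>s. s \<noteq> 0 \<Longrightarrow> \<bar>s\<bar> < \<epsilon> \<Longrightarrow> G (x + s *\<^sub>R d) \<bullet> d < 0"
      by (auto simp: eventually_at dist_real_def)
    define s where "s = \<epsilon> / 2"
    have s: "s > 0" "G (x + s *\<^sub>R d) \<bullet> d < 0" using \<epsilon> by (auto simp: s_def)
    have "F (x + s *\<^sub>R d) - s * (G (x + s *\<^sub>R d) \<bullet> d) \<le> F x"
      using above_tangent[of "x + s *\<^sub>R d" x] by simp
    then have "x + s *\<^sub>R d \<in> sublevel"
      using s F mult_pos_neg[OF s] by (simp add: sublevel_def)
    then have "s * (d \<bullet> u) \<le> 0" using u by fastforce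
    then show False using s(1) du by (simp add: mult_le_0_iff)
  qed
qed

lemma has_derivative_sgn_gradient:
  assumes "G x \<noteq> 0"
  shows "((\<lambda>y. sgn (G y)) has_derivative
    (\<lambda>v. (H x v - (sgn (G x) \<bullet> H x v) *\<^sub>R sgn (G x)) /\<^sub>R norm (G x))) (at x)"
proof -
  let ?N = "\<lambda>y. norm (G y)"
  have N: "?N x \<noteq> 0" using assms by simp
  have "(?N has_derivative (\<lambda>v. sgn (G x) \<bullet> H x v)) (at x)"
    using has_derivative_compose[OF gradient has_derivative_norm[OF assms]] by (simp add: inner_commute)
  from has_derivative_scaleR[OF Deriv.has_derivative_inverse[OF N this] gradient]
  show ?thesis
    unfolding sgn_div_norm
    by (rule has_derivative_eq_rhs) (simp add: fun_eq_iff algebra_simps sgn_div_norm)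
qed

text \<open>
  The derivative of the normalised gradient is \<open>1 / norm (G x)\<close> times the Hessian followed by projection onto
  the tangent space. On tangent vectors its quadratic form is a positive multiple of the Hessian,
  and on the normal line the extended map is the identity; so the extended map is positive
  definite and has positive determinant.
\<close>
lemma Gauss_curvature_pos:
  assumes F: "F x = c"
  shows "\<exists>\<kappa>>0. has_Gauss_curvature sublevel x \<kappa>"
proof -
  define \<nu> where "\<nu> = sgn (G x)"
  define W where "W v = (H x v - (\<nu> \<bullet> H x v) *\<^sub>R \<nu>) /\<^sub>R norm (G x)" for v
  have N: "norm (G x) > 0" using gradient_nonzero[OF F] by simp
  have \<nu>1: "\<nu> \<bullet> \<nu> = 1"
    using N unfolding power2_norm_eq_inner[symmetric] by (simp add: \<nu>_def norm_sgn)
  have "((\<lambda>y. sgn (G y)) has_derivative W) (at x within frontier sublevel)"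
    using has_derivative_at_withinI[OF has_derivative_sgn_gradient[OF gradient_nonzero[OF F]]]
    by (simp only: W_def[abs_def] \<nu>_def)
  then have deriv: "(outer_normal sublevel has_derivative W) (at x within frontier sublevel)"
    by (rule has_derivative_transform[rotated 2]) (simp_all add: frontier_sublevel outer_normal_eq F)
  define f where "f v = (let u = outer_normal sublevel x; w = (v \<bullet> u) *\<^sub>R u in W (v - w) + w)" for v
  have f_eq: "f v = W (v - (v \<bullet> \<nu>) *\<^sub>R \<nu>) + (v \<bullet> \<nu>) *\<^sub>R \<nu>" for v
    by (simp add: f_def Let_def outer_normal_eq F \<nu>_def)
  have W: "linear W" using deriv by (rule has_derivative_linear)
  have f: "linear f"
    unfolding f_eq[abs_def]
    by (intro linear_compose_add linear_compose[OF _ W, unfolded o_def] linear_compose_sub linear_ident)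
       (auto intro!: linearI simp: inner_add_left algebra_simps)
  have "det (matrix f) > 0"
  proof (rule det_pos_if_positive_definite)
    fix v :: "real^'n" assume v: "v \<noteq> 0"
    define \<tau> where "\<tau> = v - (v \<bullet> \<nu>) *\<^sub>R \<nu>"
    have \<tau>: "\<tau> \<bullet> \<nu> = 0" by (simp add: \<tau>_def inner_diff_left \<nu>1)
    have "\<nu> \<bullet> W \<tau> = 0" by (simp add: W_def inner_diff_right \<nu>1)
    moreover have "\<tau> \<bullet> W \<tau> = (\<tau> \<bullet> H x \<tau>) / norm (G x)"
      by (simp add: W_def inner_diff_right \<tau> field_simps)
    moreover have "v = \<tau> + (v \<bullet> \<nu>) *\<^sub>R \<nu>" by (simp add: \<tau>_def)
    ultimately have "v \<bullet> W \<tau> = (\<tau> \<bullet> H x \<tau>) / norm (G x)"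
      by (metis add.right_neutral inner_add_left inner_scaleR_left mult_zero_right)
    then have eq: "v \<bullet> f v = (\<tau> \<bullet> H x \<tau>) / norm (G x) + (v \<bullet> \<nu>)^2"
      by (simp add: f_eq \<tau>_def inner_add_right power2_eq_square)
    show "0 < v \<bullet> (matrix f *v v)"
      unfolding matrix_works[OF f[unfolded linear_matrix_vector_mul_eq[symmetric]]] eq
    proof (cases "\<tau> = 0")
      case True
      then have "v \<bullet> \<nu> \<noteq> 0" using v by (auto simp: \<tau>_def)
      moreover have "\<tau> \<bullet> H x \<tau> = 0" using True by simp
      ultimately show "0 < \<tau> \<bullet> H x \<tau> / norm (G x) + (v \<bullet> \<nu>)\<^sup>2" by simp
    next
      case False
      then show "0 < \<tau> \<bullet> H x \<tau> / norm (G x) + (v \<bullet> \<nu>)\<^sup>2"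
        using Hessian_pos N by (intro add_pos_nonneg) auto
    qed
  qed
  then show ?thesis
    using deriv unfolding has_Gauss_curvature_def f_def by blast
qed

end

text \<open>
  The chart replaces the coordinate \<open>x\<^sub>i\<close> by \<open>\<alpha> x\<^sub>i\<^sup>2 + E x - c\<close>. As \<open>E\<close> does not depend on \<open>x\<^sub>i\<close>, the inverse
  is obtained by solving a pure quadratic equation; \<open>\<sigma>\<close> is the sign of the root, and on the half-space
  \<open>\<sigma> x\<^sub>i > a\<close> the radicand stays positive.
\<close>
lemma level_set_chart:
  fixes E :: "real^'n::finite \<Rightarrow> real" and i :: 'n and \<alpha> a c \<sigma> :: real and M :: "(real^'n) set"
  assumes \<alpha>: "\<alpha> > 0" and a: "a \<ge> 0" and \<sigma>: "\<sigma> = 1 \<or> \<sigma> = - 1"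
    and E: "smooth_on UNIV E" and E_shift: "\<And>x s. E (x + s *\<^sub>R axis i 1) = E x"
    and U_def: "U = {x. \<sigma> * x $ i > a}"
    and M: "\<And>x. x \<in> U \<Longrightarrow> x \<in> M \<longleftrightarrow> \<alpha> * (x $ i)^2 + E x = c"
  shows "\<exists>(V :: (real^'n) set) h g. open U \<and> open V \<and> homeomorphism U V h g \<and>
    smooth_on U h \<and> smooth_on V g \<and> h ` (M \<inter> U) = V \<inter> {y. y $ i = 0}"
proof -
  let ?e = "axis i 1 :: real^'n"
  define h where "h x = x + (\<alpha> * (x $ i)^2 + E x - c - x $ i) *\<^sub>R ?e" for x
  define r where "r y = (1 / \<alpha>) * (y $ i + c - E y)" for y
  define g where "g y = y + (\<sigma> * sqrt (r y) - y $ i) *\<^sub>R ?e" for y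
  define V where "V = {y. r y > a^2}"
  have E_cont: "continuous_on UNIV E" by (rule smooth_on_continuous[OF E])
  have U: "open U" unfolding U_def by (intro open_Collect_less continuous_intros)
  have V: "open V" unfolding V_def r_def by (intro open_Collect_less continuous_intros E_cont)
  have sqrt_pos: "r y > 0" if "y \<in> V" for y
    using that le_less_trans[OF zero_le_power2[of a]] by (simp add: V_def)
  have h_i: "h x $ i = \<alpha> * (x $ i)^2 + E x - c" for x by (simp add: h_def)
  have g_i: "g y $ i = \<sigma> * sqrt (r y)" for y by (simp add: g_def)
  have Eh: "E (h x) = E x" for x unfolding h_def by (rule E_shift)
  have Eg: "E (g y) = E y" for y unfolding g_def by (rule E_shift)
  have rh: "r (h x) = (x $ i)^2" for x using \<alpha> by (simp add: r_def Eh h_i)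
  have UV: "h x \<in> V" if "x \<in> U" for x
  proof -
    have "a < \<bar>x $ i\<bar>" using that \<sigma> by (auto simp: U_def)
    then have "a^2 < \<bar>x $ i\<bar>^2" using a by (intro power_strict_mono) auto
    then show ?thesis by (simp add: V_def rh)
  qed
  have \<sigma>\<sigma>: "\<sigma> * (\<sigma> * z) = z" for z using \<sigma> by auto
  have VU: "g y \<in> U" if "y \<in> V" for y
    using that a by (simp add: U_def g_i \<sigma>\<sigma> V_def real_less_rsqrt)
  have gh: "g (h x) = x" if "x \<in> U" for x
  proof -
    have "\<sigma> * x $ i > 0" using that a by (auto simp: U_def)
    then have "\<sigma> * \<bar>x $ i\<bar> = x $ i" using \<sigma> by auto
    then have "g (h x) = h x + (x $ i - h x $ i) *\<^sub>R ?e" by (simp add: g_def rh)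
    then show ?thesis by (simp add: h_i) (simp add: h_def algebra_simps)
  qed
  have hg: "h (g y) = y" if "y \<in> V" for y
  proof -
    have "(g y $ i)^2 = r y"
      using sqrt_pos[OF that] \<sigma> by (auto simp: g_i power_mult_distrib)
    then have "h (g y) = g y + (y $ i - g y $ i) *\<^sub>R ?e"
      using \<alpha> by (simp add: h_def Eg r_def)
    then show ?thesis by (simp add: g_i) (simp add: g_def algebra_simps)
  qed
  have smooth_id: "smooth_on S (\<lambda>x. x)" if "open S" for S :: "(real^'n) set"
    using that by (intro smooth_on_bounded_linear bounded_linear_ident)
  have "smooth_on U (\<lambda>x. \<alpha> * (x $ i)^2 + E x - c - x $ i)"
    unfolding power2_eq_square
    by (intro smooth_on_minus smooth_on_add smooth_on_mult smooth_on_const smooth_on_component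
        smooth_on_subset[OF E] U) simp
  then have h: "smooth_on U h"
    unfolding h_def[abs_def] by (intro smooth_on_add smooth_on_scaleR smooth_on_const smooth_id U)
  have "smooth_on V r"
    unfolding r_def[abs_def]
    by (intro smooth_on_minus smooth_on_add smooth_on_mult smooth_on_const smooth_on_component
        smooth_on_subset[OF E] V) simp
  then have sqrt_r: "smooth_on V (\<lambda>y. sqrt (r y))"
    by (rule smooth_on_compose_real[OF V open_greaterThan _ smooth_on_sqrt, rotated]) (simp add: sqrt_pos)
  have "smooth_on V (\<lambda>y. \<sigma> * sqrt (r y) - y $ i)"
    by (intro smooth_on_minus smooth_on_mult smooth_on_const smooth_on_component sqrt_r V)
  then have g: "smooth_on V g"
    unfolding g_def[abs_def] by (intro smooth_on_add smooth_on_scaleR smooth_on_const smooth_id V)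
  have "homeomorphism U V h g"
    by (rule homeomorphismI) (use UV VU gh hg smooth_on_continuous[OF h] smooth_on_continuous[OF g] in auto)
  moreover have "h ` (M \<inter> U) = V \<inter> {y. y $ i = 0}"
  proof (intro subset_antisym subsetI)
    fix y assume "y \<in> h ` (M \<inter> U)"
    then show "y \<in> V \<inter> {y. y $ i = 0}" using UV M by (auto simp: h_i)
  next
    fix y assume y: "y \<in> V \<inter> {y. y $ i = 0}"
    then have hgy: "h (g y) = y" "g y \<in> U" using hg VU by auto
    then have "\<alpha> * (g y $ i)^2 + E (g y) = c" using h_i[of "g y"] y by simp
    then have "g y \<in> M \<inter> U" using hgy M by simp
    then show "y \<in> h ` (M \<inter> U)" by (rule rev_image_eqI) (simp add: hgy)
  qed
  ultimately have chart: "open U \<and> open V \<and> homeomorphism U V h g \<and>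
    smooth_on U h \<and> smooth_on V g \<and> h ` (M \<inter> U) = V \<inter> {y. y $ i = 0}"
    using U V h g by simp
  show ?thesis by (rule exI[of _ V], rule exI[of _ h], rule exI[of _ g], rule chart)
qed

section \<open>Dented spheroids\<close>

definition l2_off :: "'n \<Rightarrow> real^'n::finite \<Rightarrow> real" where
  "l2_off k x = sqrt (norm x ^ 2 - (x $ k)^2)"

lemma component_power2_le: "(x $ k)^2 \<le> norm x ^ 2" for x :: "real^'n::finite"
  using power_mono[OF component_le_norm_cart[of x k], of 2] by simp

lemma norm_axis_plus_axis_power2:
  "j \<noteq> k \<Longrightarrow> norm (axis k h + axis j s :: real^'n::finite) ^ 2 = h^2 + s^2"
  unfolding power2_norm_eq_inner by (simp add: inner_add inner_axis_axis power2_eq_square)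

lemma profile_gauge_l2_off:
  assumes "j \<noteq> k"
  shows "profile_gauge (l2_off k) k j"
proof
  show "continuous_on UNIV (l2_off k)"
    unfolding l2_off_def by (intro continuous_intros)
  show "l2_off k (axis k h + axis j s) = \<bar>s\<bar>" for h s
    using norm_axis_plus_axis_power2[OF assms, of h s] assms by (simp add: l2_off_def axis_def)
  show "norm x ^ 2 - (x $ k)^2 \<le> (l2_off k x)^2" "0 \<le> l2_off k x" for x
    using component_power2_le[of x k] by (simp_all add: l2_off_def)
qed (use assms in \<open>auto simp: l2_off_def\<close>)

text \<open>
  The spheroid is given by \<open>h\<^sup>2 / 4 + \<bar>x'\<bar>\<^sup>2 \<le> 4 t\<^sup>2\<close>, where \<open>h\<close> is the height and \<open>x'\<close> collects the other
  coordinates; its semiaxes are \<open>4t\<close> along the axis and \<open>2t\<close> across. The real square root is odd, so a negative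
  radicand gives a negative profile value and hence an empty section.
\<close>
definition dented_profile :: "real \<Rightarrow> (real \<Rightarrow> real) \<Rightarrow> real \<Rightarrow> real" where
  "dented_profile t \<phi> h = sqrt (4 * t^2 - (h^2 / 4 + \<phi> h))"

definition dented_spheroid :: "'n \<Rightarrow> real \<Rightarrow> (real \<Rightarrow> real) \<Rightarrow> (real^'n::finite) set" where
  "dented_spheroid k t \<phi> = profile_body (l2_off k) k (dented_profile t \<phi>)"

text \<open>
  This is \<open>h\<^sup>2 / 4 + \<bar>x'\<bar>\<^sup>2 + \<phi> h\<close>, written with the full norm of \<open>x\<close> in place of \<open>x'\<close>.
\<close>
definition dented_form :: "'n \<Rightarrow> (real \<Rightarrow> real) \<Rightarrow> real^'n::finite \<Rightarrow> real" where
  "dented_form k \<phi> x = x \<bullet> x - 3/4 * (x $ k)^2 + \<phi> (x $ k)"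

lemma dented_spheroid_eq: "dented_spheroid k t \<phi> = {x. dented_form k \<phi> x \<le> 4 * t^2}"
  by (auto simp: dented_spheroid_def profile_body_def l2_off_def dented_profile_def dented_form_def
      power2_norm_eq_inner)

lemma elongated_dented_profile:
  assumes "t > 0"
  shows "elongated (4 * t) (dented_profile t (\<lambda>h. 0))"
  unfolding elongated_def
proof (intro conjI allI impI)
  fix h assume "0 \<le> dented_profile t (\<lambda>h. 0) h"
  then have h: "h^2 \<le> 16 * t^2" by (simp add: dented_profile_def)
  then have sq: "(dented_profile t (\<lambda>h. 0) h)^2 = 4 * t^2 - h^2 / 4"
    by (simp add: dented_profile_def)
  have R: "(4 * t)^2 = 16 * t^2" by (simp add: power_mult_distrib)
  show "h\<^sup>2 + (dented_profile t (\<lambda>h. 0) h)\<^sup>2 \<le> (4 * t)\<^sup>2"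
    unfolding sq R using h by linarith
  show "h\<^sup>2 = (4 * t)\<^sup>2" if "h\<^sup>2 + (dented_profile t (\<lambda>h. 0) h)\<^sup>2 = (4 * t)\<^sup>2"
    using that unfolding sq R by linarith
qed (use assms in simp)

text \<open>
  The form is \<open>\<bar>x'\<bar>\<^sup>2 + \<omega> h\<close> with \<open>\<omega> h = h\<^sup>2 / 4 + \<phi> h\<close>, and \<open>\<omega>'' = 1/2 + \<phi>''\<close> is positive because
  \<open>\<delta> < 1/2\<close>. So both summands are convex, and together they have a positive definite Hessian.
\<close>
lemma dent_convex_sublevel:
  fixes k :: "'n::finite"
  assumes d: "dent r \<delta> \<phi>" and \<delta>: "\<delta> < 1/2" "\<delta> < c"
  shows "\<exists>G H. convex_sublevel (dented_form k \<phi> :: real^'n \<Rightarrow> real) G H c"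
proof -
  obtain \<phi>' \<phi>'' where \<phi>: "\<And>h. (\<phi> has_real_derivative \<phi>' h) (at h)"
      "\<And>h. (\<phi>' has_real_derivative \<phi>'' h) (at h)" "\<And>h. \<bar>\<phi>'' h\<bar> \<le> \<delta>"
    using d unfolding dent_def by blast
  let ?F = "dented_form k \<phi> :: real^'n \<Rightarrow> real"
  define G :: "real^'n \<Rightarrow> real^'n" where "G x = 2 *\<^sub>R x + (\<phi>' (x $ k) - 3/2 * x $ k) *\<^sub>R axis k 1" for x
  define H :: "real^'n \<Rightarrow> real^'n \<Rightarrow> real^'n"
    where "H x v = 2 *\<^sub>R v + ((\<phi>'' (x $ k) - 3/2) * v $ k) *\<^sub>R axis k 1" for x v
  have pos: "\<phi>'' h + 1/2 > 0" for h using \<phi>(3)[of h] \<delta> by linarith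
  have "convex_sublevel ?F G H c"
  proof
    fix x y :: "real^'n"
    define \<omega> where "\<omega> h = h^2 / 4 + \<phi> h" for h
    have "(\<phi>' (x $ k) + x $ k / 2) * (y $ k - x $ k) \<le> \<omega> (y $ k) - \<omega> (x $ k)"
    proof (rule f''_imp_f'[where C = UNIV and f = \<omega> and f' = "\<lambda>h. \<phi>' h + h / 2" and f'' = "\<lambda>h. \<phi>'' h + 1/2"])
      show "(\<omega> has_real_derivative \<phi>' h + h / 2) (at h)" for h
        unfolding \<omega>_def[abs_def] by (auto intro!: derivative_eq_intros \<phi>)
      show "((\<lambda>h. \<phi>' h + h / 2) has_real_derivative \<phi>'' h + 1/2) (at h)" for h
        by (auto intro!: derivative_eq_intros \<phi>)
      show "0 \<le> \<phi>'' h + 1/2" for h using pos[of h] by simp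
    qed auto
    moreover have "0 \<le> (y - x) \<bullet> (y - x) - (y $ k - x $ k)^2"
      using component_power2_le[of "y - x" k] by (simp add: power2_norm_eq_inner)
    moreover have "G x \<bullet> (y - x) =
        2 * (x \<bullet> y) - 2 * (x \<bullet> x) + (\<phi>' (x $ k) - 3/2 * x $ k) * (y $ k - x $ k)"
      by (simp add: G_def inner_add_left inner_diff_right inner_axis' right_diff_distrib)
    moreover have "(y - x) \<bullet> (y - x) = y \<bullet> y - 2 * (x \<bullet> y) + x \<bullet> x"
      by (simp add: inner_diff inner_commute)
    ultimately show "?F x + G x \<bullet> (y - x) \<le> ?F y"
      unfolding dented_form_def \<omega>_def power2_eq_square by (simp add: field_simps)
  next
    have "continuous_on UNIV \<phi>" using \<phi>(1) by (auto intro: DERIV_continuous_on)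
    then have "continuous_on UNIV (\<lambda>x :: real^'n. \<phi> (x $ k))"
      by (rule continuous_on_compose2) (auto intro!: continuous_intros)
    then show "continuous_on UNIV ?F"
      unfolding dented_form_def[abs_def] by (intro continuous_intros)
  next
    fix x :: "real^'n"
    have comp: "((\<lambda>x :: real^'n. x $ k) has_derivative (\<lambda>v. v $ k)) (at x)"
      by (intro bounded_linear_imp_has_derivative bounded_linear_vec_nth)
    from has_derivative_compose[OF this \<phi>(2)[unfolded has_field_derivative_def]]
    have comp': "((\<lambda>x :: real^'n. \<phi>' (x $ k)) has_derivative (\<lambda>v. \<phi>'' (x $ k) * v $ k)) (at x)" .
    have "H x = (\<lambda>v. 2 *\<^sub>R v + (\<phi>'' (x $ k) * v $ k - 3/2 * v $ k) *\<^sub>R axis k 1)"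
      by (simp add: H_def fun_eq_iff left_diff_distrib)
    moreover have "(G has_derivative \<dots>) (at x)"
      unfolding G_def[abs_def]
      by (intro has_derivative_add has_derivative_diff has_derivative_scaleR_right has_derivative_scaleR_left
          has_derivative_mult_right has_derivative_ident comp comp')
    ultimately show "(G has_derivative H x) (at x)" by simp
  next
    fix x v :: "real^'n" assume v: "v \<noteq> 0"
    have eq: "v \<bullet> H x v = 2 * (v \<bullet> v - (v $ k)^2) + (\<phi>'' (x $ k) + 1/2) * (v $ k)^2"
      by (simp add: H_def inner_add_right inner_axis power2_eq_square algebra_simps)
    have le: "0 \<le> v \<bullet> v - (v $ k)^2"
      using component_power2_le[of v k] by (simp add: power2_norm_eq_inner)
    show "0 < v \<bullet> H x v"
    proof (cases "v $ k = 0")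
      case True
      then show ?thesis using v by (simp add: eq)
    next
      case False
      then have "0 < (\<phi>'' (x $ k) + 1/2) * (v $ k)^2" by (intro mult_pos_pos pos) simp
      then show ?thesis using le by (simp add: eq)
    qed
  next
    have "\<phi> 0 \<le> \<delta>" using d by (auto simp: dent_def)
    then show "?F 0 < c" using \<delta> by (simp add: dented_form_def)
  qed
  then show ?thesis by blast
qed

lemma inner_self_minus_component_shift:
  "(x + s *\<^sub>R axis i 1) \<bullet> (x + s *\<^sub>R axis i 1) - ((x + s *\<^sub>R axis i 1) $ i)^2 = x \<bullet> x - (x $ i)^2"
  for x :: "real^'n::finite"
  by (simp add: inner_add inner_axis inner_axis' inner_commute power2_eq_square algebra_simps)

text \<open>
  Off the axis, some coordinate \<open>x\<^sub>i\<close> with \<open>i \<noteq> k\<close> is nonzero and enters the form through \<open>x\<^sub>i\<^sup>2\<close> alone. On the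
  axis, the bound on \<open>\<phi>\<close> forces the height to exceed \<open>3t\<close> in absolute value; there the form is the
  undented one, in which the height enters through \<open>h\<^sup>2 / 4\<close> alone.
\<close>
lemma smooth_hypersurface_level_dented_form:
  fixes k :: "'n::finite"
  assumes t: "t > 0" and d: "dent (3 * t) \<delta> \<phi>" and \<delta>: "\<delta> \<le> t^2"
  shows "smooth_hypersurface {x :: real^'n. dented_form k \<phi> x = 4 * t^2}" (is "smooth_hypersurface ?M")
  unfolding smooth_hypersurface_def
proof
  fix p assume "p \<in> ?M"
  then have p: "dented_form k \<phi> p = 4 * t^2" by simp
  have sm: "smooth_on UNIV (\<lambda>x :: real^'n. x \<bullet> x - (x $ i)^2)" for i
    unfolding power2_eq_square
    by (intro smooth_on_minus smooth_on_inner smooth_on_mult smooth_on_component smooth_on_bounded_linear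
        bounded_linear_ident open_UNIV)
  show "\<exists>(U :: (real^'n) set) (V :: (real^'n) set) h g i. open U \<and> open V \<and> p \<in> U \<and> homeomorphism U V h g \<and>
        smooth_on U h \<and> smooth_on V g \<and> h ` (?M \<inter> U) = V \<inter> {y. y $ i = 0}"
  proof (cases "\<exists>i. i \<noteq> k \<and> p $ i \<noteq> 0")
    case True
    then obtain i where i: "i \<noteq> k" "p $ i \<noteq> 0" by blast
    define \<sigma> where "\<sigma> = sgn (p $ i)"
    let ?E = "\<lambda>x :: real^'n. (x \<bullet> x - (x $ i)^2) + (\<phi> (x $ k) - 3/4 * (x $ k)^2)"
    let ?U = "{x :: real^'n. \<sigma> * x $ i > 0}"
    have "smooth_on UNIV (\<lambda>x :: real^'n. \<phi> (x $ k))"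
      using d by (intro smooth_on_compose_real[OF open_UNIV open_UNIV _ _ smooth_on_component]) (auto simp: dent_def)
    then have E: "smooth_on UNIV ?E"
      unfolding power2_eq_square[of "_ $ k"]
      by (intro smooth_on_add sm smooth_on_minus smooth_on_mult smooth_on_const smooth_on_component open_UNIV)
    have shift: "?E (x + s *\<^sub>R axis i 1) = ?E x" for x s
      using i(1) by (simp only: inner_self_minus_component_shift) (simp add: axis_def)
    have "\<exists>(V :: (real^'n) set) h g. open ?U \<and> open V \<and> homeomorphism ?U V h g \<and>
        smooth_on ?U h \<and> smooth_on V g \<and> h ` (?M \<inter> ?U) = V \<inter> {y. y $ i = 0}"
      by (rule level_set_chart[where \<alpha> = 1 and a = 0 and \<sigma> = \<sigma> and c = "4 * t^2", OF _ _ _ E shift refl])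
         (use i in \<open>auto simp: \<sigma>_def sgn_if dented_form_def\<close>)
    moreover have "p \<in> ?U" using i by (auto simp: \<sigma>_def sgn_if)
    ultimately show ?thesis by (elim exE conjE) (intro exI conjI)
  next
    case False
    define \<sigma> where "\<sigma> = sgn (p $ k)"
    let ?E = "\<lambda>x :: real^'n. x \<bullet> x - (x $ k)^2"
    let ?U = "{x :: real^'n. \<sigma> * x $ k > 3 * t}"
    have "p = axis k (p $ k)" using False by (auto simp: vec_eq_iff axis_def)
    then have "p \<bullet> p = (p $ k)^2" by (metis inner_axis_axis inner_real_def power2_eq_square)
    then have "(p $ k)^2 / 4 + \<phi> (p $ k) = 4 * t^2" using p by (simp add: dented_form_def)
    moreover have "\<phi> (p $ k) \<le> t^2" using d \<delta> unfolding dent_def by (meson order_trans)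
    ultimately have "(p $ k)^2 \<ge> 12 * t^2" by linarith
    moreover have "(3 * t)^2 = 9 * t^2" "t^2 > 0" using t by (simp_all add: power_mult_distrib)
    ultimately have "(3 * t)^2 < \<bar>p $ k\<bar>^2" unfolding power2_abs by linarith
    then have "3 * t < \<bar>p $ k\<bar>" by (rule power2_less_imp_less) simp
    then have pk: "\<sigma> * p $ k > 3 * t" "p $ k \<noteq> 0" using t by (auto simp: \<sigma>_def sgn_if abs_if split: if_splits)
    have \<phi>0: "\<phi> (x $ k) = 0" if "x \<in> ?U" for x
    proof -
      have "\<bar>x $ k\<bar> \<ge> 3 * t" using that by (auto simp: \<sigma>_def sgn_if split: if_splits)
      then show ?thesis using d by (auto simp: dent_def)
    qed
    have "\<exists>(V :: (real^'n) set) h g. open ?U \<and> open V \<and> homeomorphism ?U V h g \<and>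
        smooth_on ?U h \<and> smooth_on V g \<and> h ` (?M \<inter> ?U) = V \<inter> {y. y $ k = 0}"
    proof (rule level_set_chart[where \<alpha> = "1/4" and a = "3 * t" and \<sigma> = \<sigma> and c = "4 * t^2",
          OF _ _ _ sm inner_self_minus_component_shift refl])
      show "x \<in> ?M \<longleftrightarrow> 1/4 * (x $ k)^2 + ?E x = 4 * t^2" if "x \<in> ?U" for x
        using \<phi>0[OF that] by (simp add: dented_form_def)
    qed (use t pk in \<open>auto simp: \<sigma>_def sgn_if\<close>)
    moreover have "p \<in> ?U" using pk by simp
    ultimately show ?thesis by (elim exE conjE) (intro exI conjI)
  qed
qed

text \<open>
  An isometry that fixes the axis pointwise fixes the origin, so it is orthogonal; it preserves the norm
  and the height, and these determine membership.
\<close>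
lemma body_of_revolution_profile_body:
  fixes k :: "'n::finite"
  assumes "convex_body (profile_body (l2_off k) k f)"
  shows "body_of_revolution (profile_body (l2_off k) k f)"
  unfolding body_of_revolution_def
proof (intro conjI exI allI impI)
  let ?K = "profile_body (l2_off k) k f" and ?e = "axis k 1 :: real^'n" and ?l = "span {axis k 1 :: real^'n}"
  show "convex_body ?K" by fact
  show "affine ?l" by (intro subspace_imp_affine subspace_span)
  have "?e \<noteq> 0" by simp
  then have "dim ?l = 1" by simp
  then show "aff_dim ?l = 1" by (simp add: aff_dim_subspace)
  fix T :: "real^'n \<Rightarrow> real^'n" assume T: "isometry T \<and> (\<forall>x\<in>?l. T x = x)"
  then have T0: "T 0 = 0" and Te: "T ?e = ?e" by (auto intro: span_zero span_base)
  have orth: "orthogonal_transformation T"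
    using T T0 by (auto simp: orthogonal_transformation_isometry isometry_def)
  have "T x \<bullet> ?e = x \<bullet> ?e" for x
    using orth Te by (metis orthogonal_transformation_def)
  then have comp: "T x $ k = x $ k" for x by (simp add: inner_axis)
  have norm: "norm (T x) = norm x" for x using orth by (simp add: orthogonal_transformation_norm)
  have iff: "T x \<in> ?K \<longleftrightarrow> x \<in> ?K" for x
    by (simp add: profile_body_def l2_off_def comp norm)
  show "T ` ?K = ?K"
  proof (intro subset_antisym subsetI)
    fix y assume y: "y \<in> ?K"
    obtain x where "y = T x" using orthogonal_transformation_surj[OF orth] by (metis surjD)
    then show "y \<in> T ` ?K" using y iff by blast
  qed (use iff in blast)
qed

lemma C_infinity_plus_dented_spheroid:
  fixes k :: "'n::finite"
  assumes t: "t > 0" and d: "dent (3 * t) \<delta> \<phi>" and \<delta>: "\<delta> \<le> t^2" "\<delta> < 1/2"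
    and body: "convex_body (dented_spheroid k t \<phi>)"
  shows "C_infinity_plus (dented_spheroid k t \<phi>)"
proof -
  have "\<delta> < 4 * t^2" using \<delta>(1) t by (smt (verit) zero_less_power)
  then obtain G H where "convex_sublevel (dented_form k \<phi>) G H (4 * t^2)"
    using dent_convex_sublevel[OF d \<delta>(2)] by blast
  then interpret convex_sublevel "dented_form k \<phi>" G H "4 * t^2" .
  have eq: "dented_spheroid k t \<phi> = sublevel" by (simp add: dented_spheroid_eq sublevel_def)
  show ?thesis
    using body Gauss_curvature_pos smooth_hypersurface_level_dented_form[OF t d \<delta>(1), of k]
    by (simp add: C_infinity_plus_def eq frontier_sublevel)
qed

lemma convex_dented_spheroid:
  fixes k :: "'n::finite"
  assumes "t > 0" "dent r \<delta> \<phi>" "\<delta> \<le> t^2" "\<delta> < 1/2"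
  shows "convex (dented_spheroid k t \<phi>)"
proof -
  have "\<delta> < 4 * t^2" using assms by (smt (verit) zero_less_power)
  then obtain G H where "convex_sublevel (dented_form k \<phi>) G H (4 * t^2)"
    using dent_convex_sublevel[OF assms(2,4)] by blast
  then interpret convex_sublevel "dented_form k \<phi>" G H "4 * t^2" .
  show ?thesis using convex_sublevel_set by (simp add: dented_spheroid_eq sublevel_def)
qed

text \<open>
  The bump \<open>\<beta>\<close> sits at heights between \<open>t\<close> and \<open>2t\<close>, the bump \<open>\<gamma>\<close> between \<open>2t\<close> and \<open>3t\<close>. Below height \<open>t\<close>
  the spheroid is unchanged, so it still contains the ball of radius \<open>t\<close>, and near the poles it is
  unchanged as well.
\<close>
proposition smooth_noncongruent_slab_pair:
  assumes n: "CARD('n::finite) \<ge> 2" and t: "t > 0"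
  shows "\<exists>K L :: (real^'n) set. noncongruent_slab_pair t K L \<and>
       C_infinity_plus K \<and> body_of_revolution K \<and> C_infinity_plus L \<and> body_of_revolution L"
proof -
  obtain k j :: 'n where "j \<noteq> k"
    by (rule two_coordinates[OF n])
  then interpret profile_gauge "l2_off k" k j by (rule profile_gauge_l2_off)
  \<comment> \<open>Two bumps of size \<open>\<delta>\<close> add up to at most \<open>t\<^sup>2\<close>, which forces the boundary points
    on the axis beyond height \<open>3t\<close>, and to less than \<open>1/2\<close>, which keeps the form convex.\<close>
  define \<delta> where "\<delta> = min (t^2 / 2) (1/8)"
  have \<delta>: "\<delta> > 0" "\<delta> + \<delta> \<le> t^2" "\<delta> + \<delta> < 1/2" using t by (auto simp: \<delta>_def min_def)
  obtain \<beta> where \<beta>: "dent (3 * t) \<delta> \<beta>" "\<And>h. 0 < \<beta> h \<longleftrightarrow> t < h \<and> h < 2 * t"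
    using bump_exists[of t "2 * t" \<delta> "3 * t"] t \<delta>(1) by auto
  obtain \<gamma> where \<gamma>: "dent (3 * t) \<delta> \<gamma>" "\<And>h. 0 < \<gamma> h \<longleftrightarrow> 2 * t < h \<and> h < 3 * t"
    using bump_exists[of "2 * t" "3 * t" \<delta> "3 * t"] t \<delta>(1) by auto
  have nonneg: "0 \<le> \<beta> h" "0 \<le> \<gamma> h" for h using \<beta>(1) \<gamma>(1) by (auto simp: dent_def)
  have zero: "\<beta> h = 0" if "\<not> (t < h \<and> h < 2 * t)" for h
    using that nonneg[of h] \<beta>(2)[of h] by auto
  have zero': "\<gamma> h = 0" if "\<not> (2 * t < h \<and> h < 3 * t)" for h
    using that nonneg[of h] \<gamma>(2)[of h] by auto
  define \<phi> where "\<phi> h = \<beta> h + \<gamma> h" for h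
  define \<psi> where "\<psi> h = \<beta> h + \<gamma> (- h)" for h
  have dents: "dent (3 * t) (\<delta> + \<delta>) \<phi>" "dent (3 * t) (\<delta> + \<delta>) \<psi>"
    unfolding \<phi>_def[abs_def] \<psi>_def[abs_def] by (intro dent_add dent_reflect \<beta> \<gamma>)+
  have dent0: "dent (3 * t) (\<delta> + \<delta>) (\<lambda>h. 0)"
    using \<delta>(1) by (intro dent_mono[OF dent_0]) simp
  let ?a = "dented_profile t \<beta>" and ?b = "dented_profile t \<gamma>"
  let ?f = "dented_profile t \<phi>" and ?g = "dented_profile t \<psi>"
  have cont: "continuous_on UNIV (dented_profile t \<rho>)" if "dent (3 * t) \<epsilon> \<rho>" for \<rho> \<epsilon>
  proof -
    have "continuous_on UNIV \<rho>" using that by (auto simp: dent_def intro: smooth_on_continuous)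
    then show ?thesis unfolding dented_profile_def[abs_def] by (intro continuous_intros) auto
  qed
  have in_ball: "l2_off k x < dented_profile t \<rho> (x $ k)"
    if "norm x \<le> t" "\<rho> (x $ k) = 0" for x \<rho>
  proof -
    have "norm x ^ 2 \<le> t^2" using that(1) by (intro power_mono) auto
    moreover have "t^2 > 0" using t by simp
    ultimately have "norm x ^ 2 - (x $ k)^2 < 4 * t^2 - (x $ k)^2 / 4"
      using zero_le_power2[of "x $ k"] by linarith
    then show ?thesis by (simp add: l2_off_def dented_profile_def that(2))
  qed
  have near: "\<phi> (x $ k) = 0" "\<psi> (x $ k) = 0" if "norm x \<le> t" for x
  proof -
    have "\<bar>x $ k\<bar> \<le> t" using that component_le_norm_cart[of x k] by linarith
    then have "\<beta> (x $ k) = 0" "\<gamma> (x $ k) = 0" "\<gamma> (- (x $ k)) = 0"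
      using t by (intro zero zero'; linarith)+
    then show "\<phi> (x $ k) = 0" "\<psi> (x $ k) = 0" by (simp_all add: \<phi>_def \<psi>_def)
  qed
  have "noncongruent_slab_pair t (profile_body (l2_off k) k ?f) (profile_body (l2_off k) k ?g)"
  \<comment> \<open>At height \<open>-5t/2\<close> only the second body is dented, by the reflected bump \<open>\<gamma>\<close>; if heights
    are reversed, the dent of the second body at \<open>3t/2\<close> has to be compared with the first body at \<open>-3t/2\<close>.\<close>
  proof (rule noncongruent_slab_pair_profile_bodies[where a = ?a and b = ?b and R = "4 * t"
        and f\<^sub>0 = "dented_profile t (\<lambda>h. 0)" and u = "- (5/2) * t" and v = "- (3/2) * t"])
    show "continuous_on UNIV ?a" "continuous_on UNIV ?b" by (rule cont[OF \<beta>(1)] cont[OF \<gamma>(1)])+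
    have or: "\<beta> h = 0 \<or> \<gamma> h = 0" for h
      by (cases "h < 2 * t") (simp_all add: zero zero')
    have or': "\<beta> h = 0 \<or> \<gamma> (- h) = 0" for h
      using t by (cases "h < t") (simp_all add: zero zero')
    have min_max: "min (?a h) (dented_profile t \<rho> s) = dented_profile t (\<lambda>_. \<beta> h + \<rho> s) h \<and>
        max (?a h) (dented_profile t \<rho> s) = dented_profile t (\<lambda>h. 0) h"
      if "\<beta> h = 0 \<or> \<rho> s = 0" "0 \<le> \<rho> s" "s^2 = h^2" for h s \<rho>
      using that nonneg(1)[of h] by (auto simp: dented_profile_def min_def max_def)
    note north = min_max[where \<rho> = \<gamma> and h = h and s = h for h, OF or nonneg(2) refl]
      and south = min_max[where \<rho> = \<gamma> and h = h and s = "- h" for h, OF or' nonneg(2) power2_minus]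
    show "?f = (\<lambda>h. min (?a h) (?b h))" "?g = (\<lambda>h. min (?a h) (?b (- h)))"
      using north south
      by (simp_all add: fun_eq_iff dented_profile_def \<phi>_def \<psi>_def)
    show "max (?a h) (?b h) = dented_profile t (\<lambda>h. 0) h" "max (?a h) (?b (- h)) = dented_profile t (\<lambda>h. 0) h" for h
      using north south by simp_all
    show "elongated (4 * t) (dented_profile t (\<lambda>h. 0))" by (rule elongated_dented_profile[OF t])
    show "?f (4 * t) = 0" "?f (- (4 * t)) = 0"
      using zero zero' t by (simp_all add: dented_profile_def \<phi>_def power_mult_distrib)
    show "convex (profile_body (l2_off k) k (dented_profile t (\<lambda>h. 0)))"
      "convex (profile_body (l2_off k) k ?f)" "convex (profile_body (l2_off k) k ?g)"
      using convex_dented_spheroid[OF t _ \<delta>(2,3), of "3 * t" _ k] dents dent0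
      by (simp_all add: dented_spheroid_def)
    show "l2_off k x < ?f (x $ k)" "l2_off k x < ?g (x $ k)" if "norm x \<le> t" for x
      using in_ball[of x \<phi>] in_ball[of x \<psi>] near that by blast+
    have "\<phi> (- (5/2) * t) = 0" "\<phi> (- (3/2) * t) = 0"
      using zero zero' t by (simp_all add: \<phi>_def)
    moreover have "\<psi> (- (5/2) * t) > 0" "\<psi> (3/2 * t) > 0"
      using nonneg(1)[of "- (5/2) * t"] \<gamma>(2)[of "5/2 * t"] nonneg(2)[of "- (3/2) * t"] \<beta>(2)[of "3/2 * t"] t
      by (auto simp: \<psi>_def intro: add_nonneg_pos add_pos_nonneg)
    ultimately show "?f (- (5/2) * t) \<ge> 0" "?g (- (5/2) * t) < ?f (- (5/2) * t)"
      "?f (- (3/2) * t) \<ge> 0" "?g (- (- (3/2) * t)) < ?f (- (3/2) * t)"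
      by (simp_all add: dented_profile_def power_mult_distrib power_divide)
  qed (use t in simp_all)
  then have pair: "noncongruent_slab_pair t (dented_spheroid k t \<phi>) (dented_spheroid k t \<psi>)"
    by (simp add: dented_spheroid_def)
  then have body: "convex_body (dented_spheroid k t \<phi>)" "convex_body (dented_spheroid k t \<psi>)"
    by (simp_all add: noncongruent_slab_pair_def)
  have "C_infinity_plus (dented_spheroid k t \<phi>)" "C_infinity_plus (dented_spheroid k t \<psi>)"
    using body dents by (auto intro: C_infinity_plus_dented_spheroid[OF t _ \<delta>(2,3)])
  moreover have "body_of_revolution (dented_spheroid k t \<phi>)" "body_of_revolution (dented_spheroid k t \<psi>)"
    using body unfolding dented_spheroid_def by (auto intro: body_of_revolution_profile_body)
  ultimately show ?thesis using pair by blast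
qed

section \<open>Conclusion\<close>

theorem theorem2p7:
  fixes t :: real
  assumes "CARD('n::finite) \<ge> 2" and "t > 0"
  shows "(\<exists>K L :: (real^'n) set. noncongruent_slab_pair t K L) \<and>
    (\<exists>K L :: (real^'n) set. noncongruent_slab_pair t K L \<and>
       C_infinity_plus K \<and> body_of_revolution K \<and>
       C_infinity_plus L \<and> body_of_revolution L) \<and>
    (\<exists>K L :: (real^'n) set. noncongruent_slab_pair t K L \<and> polytope K \<and> polytope L)"
  using smooth_noncongruent_slab_pair[OF assms] polytope_noncongruent_slab_pair[OF assms] by blast

end
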